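(* For the checkerboard geometry with amplitude $\alpha$ and cell size $h=1/N$ ($N$ a positive integer), the tensor Gauss4 point set, the common candidate space $\mathcal Z_h$ and common material sum $c>0$ described in the context, assume $0<|\alpha|<1/(3\sqrt{11})$ and put $\delta=\sqrt{11}|\alpha|$ and $K_G=\frac{12(4+\sqrt{30})}{245}$. Then $$\gamma_{S,h}^*(\alpha)=c,\qquad c\,\frac{1-3\delta}{1-\delta}\le\gamma_{Q,h}^*(\alpha)\le c\left(1-\frac{K_G|\alpha|}{2(1+\delta)}\right)<c ,$$ so both exact-potential classes admit positive material margins. Moreover, for every fixed $0<\alpha_0<1/(3\sqrt{11})$, with $\delta_0=\sqrt{11}\,\alpha_0$, uniformly in $h$ and in $0<|\alpha|\le\alpha_0$, $$\frac{cK_G}{2(1+\delta_0)}|\alpha|\le c-\gamma_{Q,h}^*(\alpha)\le\frac{2c\sqrt{11}}{1-\delta_0}|\alpha| .$$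
   Context: Matrices: $A:B=\operatorname{tr}(A^TB)$; $\operatorname{cof}A$ is the matrix of signed $2\times2$ minors; $A\times B=\operatorname{cof}(A+B)-\operatorname{cof}A-\operatorname{cof}B$ for $A,B\in\mathbb R^{3\times3}$. Geometry: let $h=1/N$ and index the $N^3$ subcubes of $[0,1]^3$ by $e=(i,j,k)$, $i,j,k\in\{0,\dots,N-1\}$. For $\xi\in[-1,1]^3$ put $T_e(\xi)=\frac h2(2i+1+\xi_1,2j+1+\xi_2,2k+1+\xi_3)^T$, $\theta_e=(-1)^{i+j+k}$, $e_1=(1,0,0)^T$ and $$X_e(\xi)=T_e(\xi)+\tfrac{h\alpha}{2}\theta_e\,\xi_1^3\xi_2\xi_3\,e_1 .$$ The global map $X_h$ on $[0,1]^3$, equal to $X_e\circ T_e^{-1}$ on cell $e$, is continuous, and for $|\alpha|<1/(3\sqrt{11})$ it is injective with positive Jacobian determinant. $\Omega_h=X_h((0,1)^3)$. Polynomial spaces on $[-1,1]^3$: $\mathbb Q_3$ is the space of polynomials of degree at most $3$ in each coordinate; $\mathcal S_3$ is the span of monomials $x^{\alpha_1}y^{\alpha_2}z^{\alpha_3}$ with $\sum_{i:\alpha_i\ge2}\alpha_i\le3$. Candidates: $\mathcal Z_h=\{z\in C^0(\overline\Omega_h;\mathbb R^3): z\circ X_e\in\mathcal S_3^3\text{ for every }e\}$ (no trace prescribed). Quadrature: on every cell the tensor Gauss--Legendre rule $\mathcal G_4$ with four points per coordinate (64 points $\xi_q$ on $[-1,1]^3$). With $z_e=z\circ X_e$ and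 $D$ the parent derivative, $\mathcal T(z_e;u,v)=\mathcal G_4[Dz_e:(Du\times Dv)]-\int_{[-1,1]^3}Dz_e:(Du\times Dv)\,d\xi$. Put $\mathcal Z_{S,h}^0=\{z\in\mathcal Z_h:\mathcal T(z_e;u,v)=0\ \forall e,\ \forall u,v\in\mathcal S_3^3\}$ and $\mathcal Z_{Q,h}^0=\{z\in\mathcal Z_h:\mathcal T(z_e;u,v)=0\ \forall e,\ \forall u,v\in\mathbb Q_3^3\}$. Material: on each cell $W_{\mathrm{iso},e}(F)=c_{1,e}(J^{-2/3}F:F-3)+c_{2,e}(J^{-4/3}\operatorname{cof}F:\operatorname{cof}F-3)$, $J=\det F>0$, with $c_{1,e},c_{2,e}\ge0$ and $c_{1,e}+c_{2,e}=c>0$ for all $e$; $\mathcal H_c=D^2W_{\mathrm{iso},e}(I_3)$ (independent of $e$); $\mathcal A[H,L]=2H:L+\frac23(\operatorname{tr}H)(\operatorname{tr}L)$. Margins: with $R_z(X_e(\xi))=Dz_e(\xi)\,(DX_e(\xi))^{-1}$, $$\gamma_h(z)=\min_{e,q}\inf_{0\ne H\in\mathbb R^{3\times3}}\frac{\mathcal H_c[H,H]+R_z(X_e(\xi_q)):(H\times H)}{\mathcal A[H,H]},$$ $\gamma_{S,h}^*(\alpha)=\max_{z\in\mathcal Z_{S,h}^0}\gamma_h(z)$ and $\gamma_{Q,h}^*(\alpha)=\max_{z\in\mathcal Z_{Q,h}^0}\gamma_h(z)$ (both maxima are attained). *)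

theory Defs
  imports "HOL-Analysis.Analysis" "HOL-Computational_Algebra.Polynomial"
begin

section \<open>Matrix algebra\<close>

definition mdot :: "real^3^3 \<Rightarrow> real^3^3 \<Rightarrow> real"  (infixl \<open>:\<cdot>\<close> 70) where
  "A :\<cdot> B = trace (transpose A ** B)"

definition cof :: "real^3^3 \<Rightarrow> real^3^3" where
  "cof A = vector
    [vector [A$2$2 * A$3$3 - A$2$3 * A$3$2,
             - (A$2$1 * A$3$3 - A$2$3 * A$3$1),
             A$2$1 * A$3$2 - A$2$2 * A$3$1],
     vector [- (A$1$2 * A$3$3 - A$1$3 * A$3$2),
             A$1$1 * A$3$3 - A$1$3 * A$3$1,
             - (A$1$1 * A$3$2 - A$1$2 * A$3$1)],
     vector [A$1$2 * A$2$3 - A$1$3 * A$2$2,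
             - (A$1$1 * A$2$3 - A$1$3 * A$2$1),
             A$1$1 * A$2$2 - A$1$2 * A$2$1]]"

definition mcross :: "real^3^3 \<Rightarrow> real^3^3 \<Rightarrow> real^3^3"  (infixl \<open>\<times>\<^sub>M\<close> 71) where
  "A \<times>\<^sub>M B = cof (A + B) - cof A - cof B"

lemma matrix_mult_transpose_cof: "A ** transpose (cof A) = det A *\<^sub>R mat 1"
  by (simp add: vec_eq_iff forall_3 matrix_matrix_mult_def transpose_def cof_def mat_def
      det_3 sum_3 algebra_simps)


section \<open>Checkerboard geometry\<close>

text \<open>Triples (cell indices, exponents) are vectors of type \<^typ>\<open>nat^3\<close>.\<close>

definition ref_cube :: "(real^3) set" where
  "ref_cube = cbox (vec (-1)) (vec 1)"

definition cells :: "nat \<Rightarrow> (nat^3) set" where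
  "cells N = {e. \<forall>m. e$m < N}"

definition cell_map :: "nat \<Rightarrow> nat^3 \<Rightarrow> real^3 \<Rightarrow> real^3" where
  "cell_map N e \<xi> = (\<chi> m. (1 / real N) / 2 * (2 * real (e$m) + 1 + \<xi>$m))"

definition cell_sign :: "nat^3 \<Rightarrow> real" where
  "cell_sign e = (-1) ^ (e$1 + e$2 + e$3)"

definition geom :: "nat \<Rightarrow> real \<Rightarrow> nat^3 \<Rightarrow> real^3 \<Rightarrow> real^3" where
  "geom N \<alpha> e \<xi> = cell_map N e \<xi> +
     ((1 / real N) * \<alpha> / 2 * cell_sign e * ((\<xi>$1)^3 * \<xi>$2 * \<xi>$3)) *\<^sub>R axis 1 1"

text \<open>The cells overlap in their faces; \<open>geom_consistent\<close> and \<open>global_map_cell\<close> below show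
  that the description determines the value there too.\<close>

definition global_map :: "nat \<Rightarrow> real \<Rightarrow> real^3 \<Rightarrow> real^3" where
  "global_map N \<alpha> x =
     (THE y. \<exists>e\<in>cells N. \<exists>\<xi>\<in>ref_cube. x = cell_map N e \<xi> \<and> y = geom N \<alpha> e \<xi>)"

definition domain_h :: "nat \<Rightarrow> real \<Rightarrow> (real^3) set" where
  "domain_h N \<alpha> = global_map N \<alpha> ` box 0 (vec 1)"

lemma cell_coordinate_consistent:
  fixes a b :: nat and x y :: real
  assumes "2 * real a + x = 2 * real b + y" "\<bar>x\<bar> \<le> 1" "\<bar>y\<bar> \<le> 1"
  shows "(-1) ^ a * x = (-1) ^ b * y" and "(-1) ^ a * x ^ 3 = (-1) ^ b * y ^ 3"
proof -
  have "real a \<le> real b + 1" "real b \<le> real a + 1"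
    using assms by auto
  then have "a = b \<or> a = Suc b \<or> b = Suc a" by linarith
  then have *: "(a = b \<and> x = y) \<or> (a = Suc b \<and> x = -1 \<and> y = 1) \<or> (b = Suc a \<and> x = 1 \<and> y = -1)"
    using assms by auto
  then show "(-1) ^ a * x = (-1) ^ b * y" by auto
  show "(-1) ^ a * x ^ 3 = (-1) ^ b * y ^ 3" using * by auto
qed

lemma geom_consistent:
  assumes N: "N > 0" and \<xi>: "\<xi> \<in> ref_cube" and \<eta>: "\<eta> \<in> ref_cube"
    and eq: "cell_map N e \<xi> = cell_map N e' \<eta>"
  shows "geom N \<alpha> e \<xi> = geom N \<alpha> e' \<eta>"
proof -
  have eqm: "2 * real (e$m) + \<xi>$m = 2 * real (e'$m) + \<eta>$m" for m
    using arg_cong[OF eq, of "\<lambda>v. v$m"] N by (simp add: cell_map_def)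
  have bx: "\<bar>\<xi>$m\<bar> \<le> 1" and by': "\<bar>\<eta>$m\<bar> \<le> 1" for m
    using \<xi> \<eta> by (simp_all add: ref_cube_def mem_box_cart abs_le_iff minus_le_iff)
  note c = cell_coordinate_consistent[OF eqm bx by']
  have "cell_sign e * ((\<xi>$1)^3 * \<xi>$2 * \<xi>$3)
      = ((-1) ^ (e$1) * (\<xi>$1)^3) * ((-1) ^ (e$2) * \<xi>$2) * ((-1) ^ (e$3) * \<xi>$3)"
    by (simp add: cell_sign_def power_add)
  also have "\<dots> = ((-1) ^ (e'$1) * (\<eta>$1)^3) * ((-1) ^ (e'$2) * \<eta>$2) * ((-1) ^ (e'$3) * \<eta>$3)"
    by (simp only: c)
  also have "\<dots> = cell_sign e' * ((\<eta>$1)^3 * \<eta>$2 * \<eta>$3)"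
    by (simp add: cell_sign_def power_add)
  finally show ?thesis
    using eq by (simp add: geom_def mult.assoc)
qed

lemma global_map_cell:
  assumes "N > 0" "e \<in> cells N" "\<xi> \<in> ref_cube"
  shows "global_map N \<alpha> (cell_map N e \<xi>) = geom N \<alpha> e \<xi>"
  unfolding global_map_def
proof (rule the_equality)
  show "\<exists>e'\<in>cells N. \<exists>\<eta>\<in>ref_cube. cell_map N e \<xi> = cell_map N e' \<eta> \<and> geom N \<alpha> e \<xi> = geom N \<alpha> e' \<eta>"
    using assms by blast
next
  fix y assume "\<exists>e'\<in>cells N. \<exists>\<eta>\<in>ref_cube. cell_map N e \<xi> = cell_map N e' \<eta> \<and> y = geom N \<alpha> e' \<eta>"
  then obtain e' \<eta> where "\<eta> \<in> ref_cube" "cell_map N e \<xi> = cell_map N e' \<eta>" "y = geom N \<alpha> e' \<eta>"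
    by blast
  then show "y = geom N \<alpha> e \<xi>"
    using geom_consistent[OF assms(1,3)] by metis
qed


section \<open>Polynomial spaces on the reference cube\<close>

definition monomial :: "nat^3 \<Rightarrow> real^3 \<Rightarrow> real" where
  "monomial m x = (\<Prod>i\<in>UNIV. (x$i) ^ (m$i))"

definition Q3_exps :: "(nat^3) set" where
  "Q3_exps = {m. \<forall>i. m$i \<le> 3}"

definition S3_exps :: "(nat^3) set" where
  "S3_exps = {m. (\<Sum>i | m$i \<ge> 2. m$i) \<le> 3}"

definition monomial_span :: "(nat^3) set \<Rightarrow> (real^3 \<Rightarrow> real) set" where
  "monomial_span M = {p. \<exists>a. \<forall>x. p x = (\<Sum>m\<in>M. a m * monomial m x)}"

definition vector_span :: "(nat^3) set \<Rightarrow> (real^3 \<Rightarrow> real^3) set" where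
  "vector_span M = {u. \<forall>i. (\<lambda>x. u x $ i) \<in> monomial_span M}"

lemma finite_Q3_exps: "finite Q3_exps"
proof -
  have "Q3_exps \<subseteq> (\<lambda>(a, b, c). vector [a, b, c]) ` ({..3} \<times> {..3} \<times> {..3})"
  proof
    fix m :: "nat^3" assume m: "m \<in> Q3_exps"
    have "m = vector [m$1, m$2, m$3]" by (simp add: vec_eq_iff forall_3)
    then show "m \<in> (\<lambda>(a, b, c). vector [a, b, c]) ` ({..3} \<times> {..3} \<times> {..3})"
      using m by (intro image_eqI[of _ _ "(m$1, m$2, m$3)"]) (auto simp: Q3_exps_def)
  qed
  then show ?thesis by (rule finite_subset) auto
qed

lemma S3_exps_subset_Q3_exps: "S3_exps \<subseteq> Q3_exps"
proof
  fix m :: "nat^3" assume m: "m \<in> S3_exps"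
  have "m$i \<le> 3" for i
  proof (cases "m$i \<ge> 2")
    case True
    then have "m$i \<le> (\<Sum>i | m$i \<ge> 2. m$i)" by (intro member_le_sum) auto
    then show ?thesis using m by (simp add: S3_exps_def)
  qed simp
  then show "m \<in> Q3_exps" by (simp add: Q3_exps_def)
qed

lemma finite_S3_exps: "finite S3_exps"
  using S3_exps_subset_Q3_exps finite_Q3_exps by (rule finite_subset)


section \<open>Gauss--Legendre quadrature\<close>

fun legendre :: "nat \<Rightarrow> real poly" where
  "legendre 0 = 1"
| "legendre (Suc 0) = [:0, 1:]"
| "legendre (Suc (Suc n)) =
     smult (1 / real (n + 2))
       (smult (real (2 * n + 3)) ([:0, 1:] * legendre (Suc n)) - smult (real (n + 1)) (legendre n))"

definition gauss_nodes :: "nat \<Rightarrow> real set" where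
  "gauss_nodes n = {t. poly (legendre n) t = 0}"

definition gauss_weight :: "nat \<Rightarrow> real \<Rightarrow> real" where
  "gauss_weight n s = integral {-1..1} (\<lambda>t. \<Prod>r\<in>gauss_nodes n - {s}. (t - r) / (s - r))"

definition gauss_points :: "nat \<Rightarrow> (real^3) set" where
  "gauss_points n = {\<xi>. \<forall>i. \<xi>$i \<in> gauss_nodes n}"

definition gauss_quad :: "nat \<Rightarrow> (real^3 \<Rightarrow> real) \<Rightarrow> real" where
  "gauss_quad n f = (\<Sum>\<xi>\<in>gauss_points n. (\<Prod>i\<in>UNIV. gauss_weight n (\<xi>$i)) * f \<xi>)"


section \<open>Candidate fields and exact-potential classes\<close>

text \<open>The derivative is taken within the closed cube, so that it depends only on the values
  on the cube; it is uniquely determined there, boundary points included.\<close>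

abbreviation parent_D :: "(real^3 \<Rightarrow> real^3) \<Rightarrow> real^3 \<Rightarrow> real^3^3" where
  "parent_D f \<xi> \<equiv> jacobian f (at \<xi> within ref_cube)"

text \<open>Fields on the closure of the domain are represented by total functions; only their
  values on the closure matter in everything below.\<close>

definition candidates :: "nat \<Rightarrow> real \<Rightarrow> (real^3 \<Rightarrow> real^3) set" where
  "candidates N \<alpha> = {z. continuous_on (closure (domain_h N \<alpha>)) z \<and>
     (\<forall>e\<in>cells N. \<exists>p\<in>vector_span S3_exps. \<forall>\<xi>\<in>ref_cube. z (geom N \<alpha> e \<xi>) = p \<xi>)}"

definition quad_defect ::
    "(real^3 \<Rightarrow> real^3) \<Rightarrow> (real^3 \<Rightarrow> real^3) \<Rightarrow> (real^3 \<Rightarrow> real^3) \<Rightarrow> real" where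
  "quad_defect w u v =
     gauss_quad 4 (\<lambda>\<xi>. parent_D w \<xi> :\<cdot> (parent_D u \<xi> \<times>\<^sub>M parent_D v \<xi>))
     - integral ref_cube (\<lambda>\<xi>. parent_D w \<xi> :\<cdot> (parent_D u \<xi> \<times>\<^sub>M parent_D v \<xi>))"

definition exact_class :: "(nat^3) set \<Rightarrow> nat \<Rightarrow> real \<Rightarrow> (real^3 \<Rightarrow> real^3) set" where
  "exact_class M N \<alpha> = {z \<in> candidates N \<alpha>.
     \<forall>e\<in>cells N. \<forall>u\<in>vector_span M. \<forall>v\<in>vector_span M.
       quad_defect (\<lambda>\<xi>. z (geom N \<alpha> e \<xi>)) u v = 0}"

abbreviation Z_S :: "nat \<Rightarrow> real \<Rightarrow> (real^3 \<Rightarrow> real^3) set" where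
  "Z_S \<equiv> exact_class S3_exps"

abbreviation Z_Q :: "nat \<Rightarrow> real \<Rightarrow> (real^3 \<Rightarrow> real^3) set" where
  "Z_Q \<equiv> exact_class Q3_exps"


section \<open>Material and margins\<close>

definition W_iso :: "real \<Rightarrow> real \<Rightarrow> real^3^3 \<Rightarrow> real" where
  "W_iso c1 c2 F = c1 * (det F powr (-2/3) * (F :\<cdot> F) - 3)
                 + c2 * (det F powr (-4/3) * (cof F :\<cdot> cof F) - 3)"

text \<open>Second Frechet derivative as a bilinear form: the derivative in direction \<open>h\<close> of
  \<open>y \<mapsto> Df(y) k\<close>.\<close>

definition second_derivative :: "('a::real_normed_vector \<Rightarrow> real) \<Rightarrow> 'a \<Rightarrow> 'a \<Rightarrow> 'a \<Rightarrow> real" where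
  "second_derivative f x h k =
     frechet_derivative (\<lambda>y. frechet_derivative f (at y) k) (at x) h"

definition hess_iso :: "real \<Rightarrow> real \<Rightarrow> real^3^3 \<Rightarrow> real^3^3 \<Rightarrow> real" where
  "hess_iso c1 c2 = second_derivative (W_iso c1 c2) (mat 1)"

definition A_form :: "real^3^3 \<Rightarrow> real^3^3 \<Rightarrow> real" where
  "A_form H L = 2 * (H :\<cdot> L) + 2/3 * trace H * trace L"

text \<open>\<open>R_field N \<alpha> z e \<xi>\<close> is the field \<open>R\<^sub>z\<close> at the physical point \<open>geom N \<alpha> e \<xi>\<close>, computed in
  cell \<open>e\<close>.\<close>

definition R_field :: "nat \<Rightarrow> real \<Rightarrow> (real^3 \<Rightarrow> real^3) \<Rightarrow> nat^3 \<Rightarrow> real^3 \<Rightarrow> real^3^3" where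
  "R_field N \<alpha> z e \<xi> =
     parent_D (\<lambda>\<eta>. z (geom N \<alpha> e \<eta>)) \<xi> ** matrix_inv (parent_D (geom N \<alpha> e) \<xi>)"

definition margin ::
    "nat \<Rightarrow> real \<Rightarrow> (nat^3 \<Rightarrow> real) \<Rightarrow> (nat^3 \<Rightarrow> real) \<Rightarrow> (real^3 \<Rightarrow> real^3) \<Rightarrow> real" where
  "margin N \<alpha> c1 c2 z =
     Min ((\<lambda>(e, \<xi>). INF H\<in>UNIV - {0}.
             (hess_iso (c1 e) (c2 e) H H + R_field N \<alpha> z e \<xi> :\<cdot> (H \<times>\<^sub>M H)) / A_form H H)
          ` (cells N \<times> gauss_points 4))"

definition best_margin ::
    "(nat \<Rightarrow> real \<Rightarrow> (real^3 \<Rightarrow> real^3) set) \<Rightarrow>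
     nat \<Rightarrow> real \<Rightarrow> (nat^3 \<Rightarrow> real) \<Rightarrow> (nat^3 \<Rightarrow> real) \<Rightarrow> real" where
  "best_margin Z N \<alpha> c1 c2 = (SUP z\<in>Z N \<alpha>. margin N \<alpha> c1 c2 z)"

definition material :: "nat \<Rightarrow> real \<Rightarrow> (nat^3 \<Rightarrow> real) \<Rightarrow> (nat^3 \<Rightarrow> real) \<Rightarrow> bool" where
  "material N c c1 c2 \<longleftrightarrow> c > 0 \<and> (\<forall>e\<in>cells N. c1 e \<ge> 0 \<and> c2 e \<ge> 0 \<and> c1 e + c2 e = c)"

definition K_G :: real where
  "K_G = 12 * (4 + sqrt 30) / 245"

end

theory Submission
  imports Defs
begin

text \<open>At a Gauss point the two energies combine to
  \<open>\<H>\<^sub>c[H,H] + 2 c I : (H \<times> H) = c \<A>[H,H]\<close>, while \<open>H = e\<^sub>1 \<otimes> e\<^sub>2\<close> gives the quotient \<open>c\<close> for every field;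
  so \<open>c\<close> is the largest conceivable margin and \<open>z = 2 c x\<close> attains it. This \<open>z\<close> contains the monomial
  \<open>\<xi>\<^sub>1\<^sup>3 \<xi>\<^sub>2 \<xi>\<^sub>3\<close>, whose defect against \<open>\<S>\<^sub>3\<close> vanishes by parity or because a Jacobian determinant does. Against \<open>\<Q>\<^sub>3\<close> the pair
  \<open>\<xi>\<^sub>1\<^sup>3\<close>, \<open>\<xi>\<^sub>1\<^sup>3 \<xi>\<^sub>2\<^sup>2\<close> produces \<open>\<xi>\<^sub>1\<^sup>8\<close>, which the four-point rule does not integrate exactly, so the
  coefficient of \<open>\<xi>\<^sub>1\<^sup>3 \<xi>\<^sub>2 \<xi>\<^sub>3\<close> in \<open>z\<^sub>1\<close> must vanish in the full tensor class.

  For the upper bound, a signed sum over 16 Gauss points annihilates \<open>\<partial>\<^sub>1\<close> of every other monomial of \<open>\<S>\<^sub>3\<close>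
  and hence \<open>\<partial>\<^sub>1 z\<^sub>1\<close>, but not \<open>\<partial>\<^sub>1\<close> of the first component of the cell map; and two test matrices
  \<open>H\<close> show that the (1,1) entry of \<open>R\<^sub>z\<close> differs from \<open>2 c\<close> by at most twice the margin deficit. The
  lower bound comes from \<open>z = 2 c X\<^sub>h\<^sup>-\<^sup>1\<close>, which is affine on each parent cell. A maximiser exists because a
  lower bound on the margin bounds every entry of \<open>R\<^sub>z\<close> at the Gauss points: each matrix unit and
  its negative is a cofactor matrix.\<close>

section \<open>Four-point Gauss quadrature\<close>

text \<open>The outer and inner positive zeros of the Legendre polynomial of degree 4.\<close>

definition gl_out :: real where "gl_out = sqrt ((15 + 2 * sqrt 30) / 35)"
definition gl_in :: real where "gl_in = sqrt ((15 - 2 * sqrt 30) / 35)"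

lemma sqrt30_bounds: "5 < sqrt 30" "sqrt 30 < 6"
  by (simp_all add: real_less_rsqrt real_less_lsqrt)

lemma gl_out_sq: "gl_out^2 = (15 + 2 * sqrt 30) / 35"
  using sqrt30_bounds by (simp add: gl_out_def)

lemma gl_in_sq: "gl_in^2 = (15 - 2 * sqrt 30) / 35"
  using sqrt30_bounds by (simp add: gl_in_def)

lemma gl_pos: "0 < gl_in" "gl_in < gl_out" "0 < gl_out" "gl_out < 1"
  using sqrt30_bounds by (simp_all add: gl_in_def gl_out_def)

lemma gl_sum: "gl_out^2 + gl_in^2 = 6/7"
  by (simp add: gl_out_sq gl_in_sq field_simps)

lemma gl_prod: "gl_out^2 * gl_in^2 = 3/35"
proof -
  have "gl_out^2 * gl_in^2 = (15^2 - 4 * (sqrt 30)^2) / 35^2"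
    unfolding gl_out_sq gl_in_sq by (simp add: field_simps)
  then show ?thesis by simp
qed

text \<open>The signed Gauss-point sum \<open>node_functional\<close>, applied to the first partial
  derivative of the perturbation monomial, produces this product of nodes; this is the origin of the
  constant.\<close>

lemma K_G_gl: "K_G = gl_out^2 * (gl_out^2 - gl_in^2)"
proof -
  have "gl_out^2 * gl_out^2 = (15^2 + 60 * sqrt 30 + 4 * (sqrt 30)^2) / 35^2"
    unfolding gl_out_sq by (simp add: field_simps)
  then show ?thesis
    by (simp only: right_diff_distrib gl_prod) (simp add: K_G_def)
qed

lemma K_G_pos: "0 < K_G"
  by (simp add: K_G_def add_pos_pos)

lemma poly_legendre4: "poly (legendre 4) t = 35/8 * ((t^2 - gl_out^2) * (t^2 - gl_in^2))"
proof -
  have "(t^2 - gl_out^2) * (t^2 - gl_in^2)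
      = t^4 - (gl_out^2 + gl_in^2) * t^2 + gl_out^2 * gl_in^2"
    by (simp add: algebra_simps power2_eq_square power4_eq_xxxx)
  then have *: "(t^2 - gl_out^2) * (t^2 - gl_in^2) = t^4 - 6/7 * t^2 + 3/35"
    by (simp only: gl_sum gl_prod)
  have "poly (legendre 4) t = (35 * t^4 - 30 * t^2 + 3) / 8"
    by (simp add: numeral_eq_Suc field_simps)
  then show ?thesis unfolding * by (simp add: field_simps)
qed

lemma gauss_nodes4: "gauss_nodes 4 = {gl_out, - gl_out, gl_in, - gl_in}"
  by (auto simp: gauss_nodes_def poly_legendre4 power2_eq_iff)

lemma gauss_nodes4_abs: "t \<in> gauss_nodes 4 \<Longrightarrow> \<bar>t\<bar> \<le> 1"
  using gl_pos by (auto simp: gauss_nodes4)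

lemma integral_quadratic:
  fixes a b c :: real
  shows "integral {-1..1} (\<lambda>t. a * t^3 + b * t^2 + c * t + d) = 2/3 * b + 2 * d"
proof (rule integral_unique)
  have "((\<lambda>t. a * t^3 + b * t^2 + c * t + d) has_integral
     ((a/4*1^4+b/3*1^3+c/2*1^2+d*1) - (a/4*(-1)^4+b/3*(-1)^3+c/2*(-1)^2+d*(-1)))) {-1..1}"
    by (rule fundamental_theorem_of_calculus)
      (auto intro!: derivative_eq_intros simp: has_real_derivative_iff_has_vector_derivative[symmetric])
  then show "((\<lambda>t. a * t^3 + b * t^2 + c * t + d) has_integral (2/3 * b + 2 * d)) {-1..1}"
    by simp
qed

text \<open>The Lagrange polynomial of \<open>p\<close> is (t + p)(t^2 - q^2) divided by its value
  at \<open>p\<close>, and only its even part p (t^2 - q^2) has a nonzero integral. As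
  \<open>p\<close> may be any of the four nodes, all weights are instances.\<close>

lemma gauss_weight_pair:
  assumes nodes: "gauss_nodes 4 = {p, -p, q, -q}" and "p \<noteq> 0" "q \<noteq> 0" "p^2 \<noteq> q^2"
  shows "gauss_weight 4 p = (1/3 - q^2) / (p^2 - q^2)"
proof -
  have ne: "p \<noteq> q" "p \<noteq> -q" using assms(4) by auto
  have "gauss_nodes 4 - {p} = {-p, q, -q}" using nodes assms(2) ne by auto
  then have "(\<Prod>r\<in>gauss_nodes 4 - {p}. (t - r) / (p - r))
      = (t - -p) / (p - -p) * ((t - q) / (p - q) * ((t - -q) / (p - -q)))" for t
    using assms(3) ne by (simp add: minus_equation_iff[of p])
  also have "\<dots> t = 1 / (2*p*(p^2-q^2)) * t^3 + p / (2*p*(p^2-q^2)) * t^2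
      + (-(q^2)) / (2*p*(p^2-q^2)) * t + (-p*q^2) / (2*p*(p^2-q^2))" for t
  proof -
    have "(t - -p) / (p - -p) * ((t - q) / (p - q) * ((t - -q) / (p - -q)))
      = ((t + p) * (t^2 - q^2)) / (2*p*(p^2-q^2))"
      by (simp add: power2_eq_square square_diff_square_factored ac_simps)
    also have "(t + p) * (t^2 - q^2) = t^3 + p * t^2 - q^2 * t - p*q^2"
      by (simp add: algebra_simps power2_eq_square power3_eq_cube)
    finally show ?thesis by (simp add: add_divide_distrib diff_divide_distrib)
  qed
  finally have "gauss_weight 4 p = 2/3 * (p / (2*p*(p^2-q^2))) + 2 * ((-p*q^2) / (2*p*(p^2-q^2)))"
    unfolding gauss_weight_def by (simp only: integral_quadratic)
  also have "\<dots> = (2/3 * p + 2 * (-p*q^2)) / (2*p*(p^2-q^2))"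
    by (simp only: times_divide_eq_right add_divide_distrib)
  also have "\<dots> = (2*p*(1/3 - q^2)) / (2*p*(p^2-q^2))"
    by (simp add: algebra_simps)
  also have "\<dots> = (1/3 - q^2) / (p^2 - q^2)"
    using assms(2) by simp
  finally show ?thesis .
qed

definition w_out :: real where "w_out = (1/3 - gl_in^2) / (gl_out^2 - gl_in^2)"
definition w_in :: real where "w_in = (1/3 - gl_out^2) / (gl_in^2 - gl_out^2)"

lemma gl_sq_less: "gl_in^2 < gl_out^2"
  using gl_pos by (simp add: power_strict_mono)

lemma gauss_weight4:
  "gauss_weight 4 gl_out = w_out" "gauss_weight 4 (- gl_out) = w_out"
  "gauss_weight 4 gl_in = w_in" "gauss_weight 4 (- gl_in) = w_in"
  using gauss_weight_pair[of gl_out gl_in] gauss_weight_pair[of "-gl_out" gl_in]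
    gauss_weight_pair[of gl_in gl_out] gauss_weight_pair[of "-gl_in" gl_out] gl_pos gl_sq_less
  by (auto simp: gauss_nodes4 insert_commute w_out_def w_in_def)

section \<open>One-dimensional moments and the degree of exactness\<close>

definition gauss_moment :: "nat \<Rightarrow> real" where
  "gauss_moment n = (\<Sum>t\<in>gauss_nodes 4. gauss_weight 4 t * t^n)"

definition moment :: "nat \<Rightarrow> real" where
  "moment n = integral {-1..1} (\<lambda>t. t^n)"

lemma has_integral_power: "((\<lambda>t::real. t^n) has_integral ((1 - (-1)^Suc n) / Suc n)) {-1..1}"
proof -
  have "((\<lambda>t::real. t^n) has_integral (1^Suc n / Suc n - (-1)^Suc n / Suc n)) {-1..1}"
  proof (rule fundamental_theorem_of_calculus)
    fix x :: real
    have "((\<lambda>t. t^Suc n / Suc n) has_real_derivative (real (Suc n) * x^n / Suc n)) (at x within {-1..1})"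
      by (rule DERIV_cdivide) (use DERIV_pow[of "Suc n" x "{-1..1}"] in \<open>simp del: of_nat_Suc\<close>)
    then show "((\<lambda>t. t^Suc n / Suc n) has_vector_derivative x^n) (at x within {-1..1})"
      by (simp add: has_real_derivative_iff_has_vector_derivative del: of_nat_Suc)
  qed simp
  then show ?thesis by (simp only: diff_divide_distrib power_one)
qed

lemma moment_eq: "moment n = (if even n then 2 / Suc n else 0)"
  unfolding moment_def using has_integral_power[of n, THEN integral_unique] by simp

lemma gauss_moment_eq:
  "gauss_moment n = (if even n then 2 * (w_out * gl_out^n + w_in * gl_in^n) else 0)"
proof -
  have "distinct [gl_out, - gl_out, gl_in, - gl_in]" using gl_pos by auto
  then show ?thesis
    unfolding gauss_moment_def gauss_nodes4 by (simp add: gauss_weight4)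
qed

lemma gauss_moment_low:
  "gauss_moment 0 = 2" "gauss_moment 2 = 2/3"
proof -
  have d: "gl_out^2 - gl_in^2 \<noteq> 0" using gl_sq_less by simp
  have w: "w_in = - (1/3 - gl_out^2) / (gl_out^2 - gl_in^2)"
    unfolding w_in_def by (metis minus_diff_eq minus_divide_left minus_divide_right)
  have "w_out + w_in = 1"
  proof -
    have "w_out + w_in = (gl_out^2 - gl_in^2) / (gl_out^2 - gl_in^2)"
      by (simp only: w_out_def w add_divide_distrib[symmetric]) simp
    then show ?thesis using d by simp
  qed
  then show "gauss_moment 0 = 2" by (simp add: gauss_moment_eq)
  have "w_out * gl_out^2 + w_in * gl_in^2 = 1/3"
  proof -
    have "w_out * gl_out^2 + w_in * gl_in^2
        = ((1/3 - gl_in^2) * gl_out^2 + - (1/3 - gl_out^2) * gl_in^2) / (gl_out^2 - gl_in^2)"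
      by (simp only: w_out_def w times_divide_eq_left add_divide_distrib)
    also have "(1/3 - gl_in^2) * gl_out^2 + - (1/3 - gl_out^2) * gl_in^2 = 1/3 * (gl_out^2 - gl_in^2)"
      by (simp add: algebra_simps)
    finally show ?thesis using d by simp
  qed
  then show "gauss_moment 2 = 2/3" by (simp add: gauss_moment_eq)
qed

text \<open>The squared nodes are the roots of \<open>y^2 - 6/7 y + 3/35\<close>.\<close>

lemma gauss_moment_step:
  "gauss_moment (n + 4) = 6/7 * gauss_moment (n + 2) - 3/35 * gauss_moment n"
proof -
  have step: "y^(n+4) = 6/7 * y^(n+2) - 3/35 * y^n" if "y \<in> {gl_out, gl_in}" for y :: real
  proof -
    have "y^4 = (gl_out^2 + gl_in^2) * y^2 - gl_out^2 * gl_in^2"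
      using that by (auto simp: algebra_simps power2_eq_square power4_eq_xxxx)
    then have "y^4 = 6/7 * y^2 - 3/35" by (simp only: gl_sum gl_prod)
    then show ?thesis by (simp only: power_add) (simp add: algebra_simps)
  qed
  show ?thesis
    by (simp add: gauss_moment_eq step algebra_simps)
qed

lemma gauss_moment_even:
  "gauss_moment 4 = 2/5" "gauss_moment 6 = 2/7" "gauss_moment 8 = 258/1225"
proof -
  have step: "gauss_moment k = 6/7 * gauss_moment m - 3/35 * gauss_moment n"
    if "k = n + 4" "m = n + 2" for k m n
    using gauss_moment_step that by simp
  have "gauss_moment 4 = 6/7 * gauss_moment 2 - 3/35 * gauss_moment 0" by (rule step) simp_all
  then show g4: "gauss_moment 4 = 2/5" by (simp only: gauss_moment_low) simp
  have "gauss_moment 6 = 6/7 * gauss_moment 4 - 3/35 * gauss_moment 2" by (rule step) simp_all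
  then show g6: "gauss_moment 6 = 2/7" by (simp only: gauss_moment_low g4) simp
  have "gauss_moment 8 = 6/7 * gauss_moment 6 - 3/35 * gauss_moment 4" by (rule step) simp_all
  then show "gauss_moment 8 = 258/1225" by (simp add: g6 g4)
qed

text \<open>By symmetry both moments vanish in every odd degree; the even degrees up to 6 are
  computed.\<close>

lemma gauss_moment_exact:
  assumes "n \<le> 7 \<or> odd n"
  shows "gauss_moment n = moment n"
proof (cases "even n")
  case True
  then have "n = 0 \<or> n = 2 \<or> n = 4 \<or> n = 6" using assms by presburger
  then show ?thesis by (auto simp: moment_eq gauss_moment_low gauss_moment_even)
qed (simp add: moment_eq gauss_moment_eq)

text \<open>The first failure of the rule: 258/1225 against 2/9. This gap is what constrains the
  fields of \<open>Z_Q\<close>.\<close>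

lemma gauss_moment_8: "gauss_moment 8 \<noteq> moment 8"
  by (simp add: moment_eq gauss_moment_even)

section \<open>Quadrature error of monomials\<close>

lemma prod_UNIV_3: "prod f (UNIV :: 3 set) = f 1 * f 2 * f 3"
  unfolding UNIV_3 by (simp add: mult.assoc)

lemma monomial_eq: "monomial m x = x$1^(m$1) * x$2^(m$2) * x$3^(m$3)"
  by (simp add: monomial_def prod_UNIV_3)

lemma finite_gauss_points4: "finite (gauss_points 4)"
proof -
  have "gauss_points 4 \<subseteq> (\<lambda>(a, b, c). vector [a, b, c]) ` (gauss_nodes 4 \<times> gauss_nodes 4 \<times> gauss_nodes 4)"
  proof
    fix m :: "real^3" assume m: "m \<in> gauss_points 4"
    have "m = vector [m$1, m$2, m$3]" by (simp add: vec_eq_iff forall_3)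
    then show "m \<in> (\<lambda>(a, b, c). vector [a, b, c]) ` (gauss_nodes 4 \<times> gauss_nodes 4 \<times> gauss_nodes 4)"
      using m by (intro image_eqI[of _ _ "(m$1, m$2, m$3)"]) (auto simp: gauss_points_def)
  qed
  then show ?thesis by (rule finite_subset) (simp add: gauss_nodes4)
qed

lemma gauss_points4_ref_cube: "\<xi> \<in> gauss_points 4 \<Longrightarrow> \<xi> \<in> ref_cube"
  using gauss_nodes4_abs by (fastforce simp: gauss_points_def ref_cube_def mem_box_cart abs_le_iff)

text \<open>The tensor rule factorises: expanding the product of one-dimensional sums gives a sum
  over functions into the nodes, and these are the Gauss points.\<close>

lemma gauss_quad_monomial: "gauss_quad 4 (monomial n) = (\<Prod>i\<in>UNIV. gauss_moment (n$i))"
proof -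
  have "(\<Prod>i\<in>UNIV. gauss_moment (n$i))
      = (\<Sum>g\<in>PiE UNIV (\<lambda>_. gauss_nodes 4). \<Prod>i\<in>UNIV. gauss_weight 4 (g i) * g i ^ (n$i))"
    unfolding gauss_moment_def by (subst prod_sum_PiE) (auto simp: gauss_nodes4)
  also have "\<dots> = (\<Sum>\<xi>\<in>gauss_points 4. \<Prod>i\<in>UNIV. gauss_weight 4 (\<xi>$i) * \<xi>$i ^ (n$i))"
    by (rule sum.reindex_bij_witness[of _ "\<lambda>\<xi> i. \<xi>$i" "\<lambda>g. \<chi> i. g i"])
      (auto simp: gauss_points_def)
  finally show ?thesis by (simp add: gauss_quad_def monomial_def prod.distrib)
qed

text \<open>Fubini on a cube, by way of the product measure behind \<open>lborel\<close>; the
  indicator of each side is absorbed into its factor \<open>F i\<close>.\<close>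

lemma set_integral_cbox_prod:
  fixes f :: "3 \<Rightarrow> real \<Rightarrow> real"
  assumes f: "\<And>i. continuous_on {-1..1} (f i)"
  shows "integral ref_cube (\<lambda>x. \<Prod>i\<in>UNIV. f i (x$i)) = (\<Prod>i\<in>UNIV. integral {-1..1} (f i))"
proof -
  define F where "F i t = indicator {-1..1} t * f i t" for i t
  \<comment> \<open>That product measure is indexed by basis vectors, so the factors are reindexed
    from coordinates to basis vectors.\<close>
  define B where "B b = F (THE i. b = axis i 1)" for b :: "real^3"
  have B: "B (axis i 1) = F i" for i
    unfolding B_def by (simp add: axis_eq_axis)
  have intF: "integrable lborel (F i)" for i
    using borel_integrable_atLeastAtMost'[OF f] by (simp add: set_integrable_def F_def[abs_def])
  have mF[measurable]: "F i \<in> borel_measurable borel" for i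
    using intF by (auto dest: borel_measurable_integrable)
  have intF_eq: "integral\<^sup>L lborel (F i) = integral {-1..1} (f i)" for i
    using set_borel_integral_eq_integral(2)[of "{-1..1}" "f i"] borel_integrable_atLeastAtMost'[OF f]
    by (simp add: set_lebesgue_integral_def F_def[abs_def])
  have prodF: "(\<Prod>i\<in>UNIV. F i (x$i)) = indicator ref_cube x * (\<Prod>i\<in>UNIV. f i (x$i))" for x :: "real^3"
  proof -
    have "(\<Prod>i\<in>UNIV. indicator {-1..1} (x$i) :: real) = indicator ref_cube x"
      by (auto simp: ref_cube_def mem_box_cart indicator_def prod_zero_iff)
    then show ?thesis by (simp add: F_def prod.distrib)
  qed
  interpret product_sigma_finite "\<lambda>_::real^3. lborel :: real measure" ..
  have bas: "(\<Prod>b\<in>Basis. g b) = (\<Prod>i\<in>UNIV. g (axis i 1))" for g :: "real^3 \<Rightarrow> real"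
  proof -
    have 1: "(Basis :: (real^3) set) = range (\<lambda>i. axis i 1)" by (auto simp: Basis_vec_def)
    have 2: "inj (\<lambda>i. axis i 1 :: real^3)" by (simp add: inj_on_def axis_eq_axis)
    show ?thesis unfolding 1 prod.reindex[OF 2] by (simp add: comp_def)
  qed
  have Bm[measurable]: "B b \<in> borel_measurable borel" for b by (simp add: B_def)
  have "integral\<^sup>L lborel (\<lambda>x::real^3. \<Prod>b\<in>Basis. B b (x \<bullet> b))
      = integral\<^sup>L (\<Pi>\<^sub>M b\<in>Basis. lborel) (\<lambda>y. \<Prod>b\<in>Basis. B b ((\<Sum>b\<in>Basis. y b *\<^sub>R b) \<bullet> b))"
    by (subst lborel_eq, subst integral_distr) (auto intro!: borel_measurable_prod)
  also have "\<dots> = integral\<^sup>L (\<Pi>\<^sub>M b\<in>Basis. lborel) (\<lambda>y. \<Prod>b\<in>Basis. B b (y b))"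
    by (intro Bochner_Integration.integral_cong refl prod.cong) auto
  also have "\<dots> = (\<Prod>b\<in>Basis. integral\<^sup>L lborel (B b))"
    using intF by (intro product_integral_prod) (auto simp: B_def)
  finally have main: "integral\<^sup>L lborel (\<lambda>x::real^3. \<Prod>i\<in>UNIV. F i (x$i)) = (\<Prod>i\<in>UNIV. integral\<^sup>L lborel (F i))"
    by (simp add: bas B inner_axis)
  have cont: "continuous_on ref_cube (\<lambda>x::real^3. \<Prod>i\<in>UNIV. f i (x$i))"
  proof (intro continuous_on_prod)
    fix i :: 3
    show "continuous_on ref_cube (\<lambda>x::real^3. f i (x$i))"
      by (rule continuous_on_compose2[OF f])
        (auto intro!: continuous_intros simp: ref_cube_def mem_box_cart)
  qed
  have "set_integrable lborel ref_cube (\<lambda>x::real^3. \<Prod>i\<in>UNIV. f i (x$i))"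
    unfolding set_integrable_def using cont
    by (intro borel_integrable_compact) (auto simp: ref_cube_def)
  from set_borel_integral_eq_integral(2)[OF this]
  show ?thesis
    using main by (simp add: set_lebesgue_integral_def prodF intF_eq)
qed

lemma integral_monomial: "integral ref_cube (monomial n) = (\<Prod>i\<in>UNIV. moment (n$i))"
  unfolding monomial_def[abs_def] moment_def
  by (subst set_integral_cbox_prod) (auto intro!: continuous_intros)

definition quad_error :: "(real^3 \<Rightarrow> real) \<Rightarrow> real" where
  "quad_error f = gauss_quad 4 f - integral ref_cube f"

lemma quad_error_monomial:
  "quad_error (monomial n) = (\<Prod>i\<in>UNIV. gauss_moment (n$i)) - (\<Prod>i\<in>UNIV. moment (n$i))"
  by (simp add: quad_error_def gauss_quad_monomial integral_monomial)

lemma quad_error_monomial_exact: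
  assumes "\<forall>i. n$i \<le> 7 \<or> odd (n$i)"
  shows "quad_error (monomial n) = 0"
  using assms by (simp add: quad_error_monomial gauss_moment_exact)

text \<open>One odd exponent annihilates the rule and the integral alike, however large the other
  exponents are.\<close>

lemma quad_error_monomial_odd:
  assumes "odd (n$i)"
  shows "quad_error (monomial n) = 0"
proof -
  have "gauss_moment (n$i) = 0" "moment (n$i) = 0"
    using assms by (simp_all add: gauss_moment_eq moment_eq)
  then have "(\<Prod>i\<in>UNIV. gauss_moment (n$i)) = 0" "(\<Prod>i\<in>UNIV. moment (n$i)) = 0"
    by (metis UNIV_I finite prod_zero)+
  then show ?thesis by (simp only: quad_error_monomial)
qed

section \<open>Parent derivatives of polynomial fields\<close>

text \<open>At exponent 0 the truncated predecessor is harmless, because the factor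
  \<open>real (m$i)\<close> is 0.\<close>

definition monomial_grad :: "nat^3 \<Rightarrow> real^3 \<Rightarrow> real^3" where
  "monomial_grad m x = vector
    [real (m$1) * x$1^(m$1 - 1) * x$2^(m$2) * x$3^(m$3),
     x$1^(m$1) * (real (m$2) * x$2^(m$2 - 1)) * x$3^(m$3),
     x$1^(m$1) * x$2^(m$2) * (real (m$3) * x$3^(m$3 - 1))]"

lemma has_derivative_monomial:
  "(monomial m has_derivative (\<lambda>h. monomial_grad m x \<bullet> h)) (at x within S)"
proof -
  have c: "((\<lambda>x::real^3. x$i) has_derivative (\<lambda>h. h$i)) (at x within S)" for i
    by (rule bounded_linear_imp_has_derivative) (rule bounded_linear_vec_nth)
  show ?thesis
    unfolding monomial_eq[abs_def] monomial_grad_def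
    by (rule derivative_eq_intros c refl)+
      (simp add: inner_vec_def sum_3 algebra_simps)
qed

lemma continuous_on_monomial: "continuous_on S (monomial m)"
  unfolding monomial_eq[abs_def] by (intro continuous_intros)

lemma continuous_on_monomial_grad: "continuous_on S (\<lambda>x. monomial_grad m x $ i)"
  using exhaust_3[of i] by (elim disjE) (simp_all add: monomial_grad_def continuous_intros)

lemma has_derivative_vec_lambda:
  assumes "\<And>i. ((\<lambda>x. f x i) has_derivative (\<lambda>h. f' h i)) (at x within S)"
  shows "((\<lambda>x. \<chi> i. (f x i :: real)) has_derivative (\<lambda>h. \<chi> i. f' h i)) (at x within S)"
  using assms by (subst has_derivative_componentwise_within) (auto simp: Basis_vec_def inner_axis)

text \<open>The cube has nondegenerate sides, so a derivative within it is unique even at boundary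
  points; any formula valid on the cube may be differentiated instead.\<close>

lemma parent_D_eqI:
  assumes "(p has_derivative p') (at \<xi> within ref_cube)" "\<And>\<eta>. \<eta> \<in> ref_cube \<Longrightarrow> f \<eta> = p \<eta>" "\<xi> \<in> ref_cube"
  shows "parent_D f \<xi> = matrix p'"
proof -
  have "(f has_derivative p') (at \<xi> within ref_cube)"
    using assms(1) by (rule has_derivative_transform[OF assms(3), rotated]) (rule assms(2))
  then have "frechet_derivative f (at \<xi> within ref_cube) = p'"
    unfolding ref_cube_def
    by (rule frechet_derivative_within_cbox[rotated 2])
      (use assms(3) in \<open>auto simp: ref_cube_def Basis_vec_def inner_axis\<close>)
  then show ?thesis by (simp add: jacobian_def)
qed

lemma parent_D_polynomial:
  assumes f: "\<And>\<eta> i. \<eta> \<in> ref_cube \<Longrightarrow> f \<eta> $ i = (\<Sum>m\<in>M. a i m * monomial m \<eta>)" and \<xi>: "\<xi> \<in> ref_cube"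
  shows "parent_D f \<xi> $ i = (\<Sum>m\<in>M. a i m *\<^sub>R monomial_grad m \<xi>)"
proof -
  let ?p = "\<lambda>\<eta>. \<chi> i. \<Sum>m\<in>M. a i m * monomial m \<eta>"
  let ?p' = "\<lambda>h. \<chi> i. \<Sum>m\<in>M. a i m * (monomial_grad m \<xi> \<bullet> h)"
  have "(?p has_derivative ?p') (at \<xi> within ref_cube)"
    by (intro has_derivative_vec_lambda has_derivative_sum has_derivative_mult_right has_derivative_monomial)
  then have "parent_D f \<xi> = matrix ?p'"
    by (rule parent_D_eqI) (simp_all add: vec_eq_iff f \<xi>)
  then show ?thesis
    by (simp add: matrix_def vec_eq_iff inner_axis)
qed

lemma vector_spanD:
  assumes "u \<in> vector_span M"
  shows "\<exists>a. \<forall>x i. u x $ i = (\<Sum>m\<in>M. a i m * monomial m x)"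
proof -
  have "\<forall>i. \<exists>a. \<forall>x. u x $ i = (\<Sum>m\<in>M. a m * monomial m x)"
    using assms by (auto simp: vector_span_def monomial_span_def)
  then show ?thesis by metis
qed

section \<open>The quadrature defect in coefficients\<close>

text \<open>The determinant with rows \<open>a\<close>, \<open>b\<close>, \<open>c\<close>, written
  so that bilinearity of \<open>cross3\<close> applies.\<close>

definition triple :: "real^3 \<Rightarrow> real^3 \<Rightarrow> real^3 \<Rightarrow> real" where
  "triple a b c = a \<bullet> cross3 b c"

lemma triple_eq:
  "triple a b c = a$1 * (b$2 * c$3 - b$3 * c$2) + a$2 * (b$3 * c$1 - b$1 * c$3)
    + a$3 * (b$1 * c$2 - b$2 * c$1)"
  by (simp add: triple_def cross3_def inner_vec_def sum_3)

lemma triple_sum: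
  "triple (\<Sum>m\<in>M. a m *\<^sub>R f m) (\<Sum>n\<in>K. b n *\<^sub>R g n) (\<Sum>l\<in>L. c l *\<^sub>R h l)
    = (\<Sum>(m, n, l)\<in>M \<times> K \<times> L. (a m * b n * c l) * triple (f m) (g n) (h l))"
proof -
  have "cross3 (\<Sum>n\<in>K. b n *\<^sub>R g n) (\<Sum>l\<in>L. c l *\<^sub>R h l)
      = (\<Sum>(n, l)\<in>K \<times> L. cross3 (b n *\<^sub>R g n) (c l *\<^sub>R h l))"
    by (rule bilinear_sum[OF bilinear_cross])
  also have "\<dots> = (\<Sum>(n, l)\<in>K \<times> L. (b n * c l) *\<^sub>R cross3 (g n) (h l))"
    by (intro sum.cong refl) (auto simp: cross_mult_left cross_mult_right)
  finally have "triple (\<Sum>m\<in>M. a m *\<^sub>R f m) (\<Sum>n\<in>K. b n *\<^sub>R g n) (\<Sum>l\<in>L. c l *\<^sub>R h l)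
      = (\<Sum>m\<in>M. \<Sum>x\<in>K \<times> L. a m * (f m \<bullet> (case x of (n, l) \<Rightarrow> (b n * c l) *\<^sub>R cross3 (g n) (h l))))"
    by (simp only: triple_def inner_sum_left inner_sum_right inner_scaleR_left sum_distrib_left) (rule sum.swap)
  also have "\<dots> = (\<Sum>(m, n, l)\<in>M \<times> K \<times> L. (a m * b n * c l) * triple (f m) (g n) (h l))"
    unfolding sum.cartesian_product
    by (intro sum.cong refl) (auto simp: triple_def)
  finally show ?thesis .
qed

text \<open>The polarised determinant: each of the three matrices contributes one row, in all six
  ways, and the signs restore the order of the rows.\<close>

lemma mdot_mcross:
  "W :\<cdot> (U \<times>\<^sub>M V) =
     triple (W$1) (U$2) (V$3) - triple (W$1) (U$3) (V$2)
   + triple (W$2) (U$3) (V$1) - triple (W$2) (U$1) (V$3)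
   + triple (W$3) (U$1) (V$2) - triple (W$3) (U$2) (V$1)"
  by (simp add: mdot_def mcross_def cof_def trace_def transpose_def matrix_matrix_mult_def sum_3
      triple_eq algebra_simps)

lemma quad_error_sum:
  assumes "finite M" "\<And>m. m \<in> M \<Longrightarrow> continuous_on ref_cube (f m)"
  shows "quad_error (\<lambda>x. \<Sum>m\<in>M. c m * f m x) = (\<Sum>m\<in>M. c m * quad_error (f m))"
proof -
  have "f m integrable_on ref_cube" if "m \<in> M" for m
    unfolding ref_cube_def by (rule integrable_continuous) (use assms that in \<open>simp add: ref_cube_def\<close>)
  then have "integral ref_cube (\<lambda>x. \<Sum>m\<in>M. c m * f m x) = (\<Sum>m\<in>M. c m * integral ref_cube (f m))"
    using assms(1) by (subst integral_sum) (auto intro: integrable_on_mult_right)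
  moreover have "gauss_quad 4 (\<lambda>x. \<Sum>m\<in>M. c m * f m x) = (\<Sum>m\<in>M. c m * gauss_quad 4 (f m))"
    unfolding gauss_quad_def sum_distrib_left
    by (subst sum.swap) (simp add: mult.left_commute)
  ultimately show ?thesis
    by (simp add: quad_error_def sum_subtractf right_diff_distrib)
qed

lemma quad_error_cong:
  assumes "\<And>\<xi>. \<xi> \<in> ref_cube \<Longrightarrow> f \<xi> = g \<xi>"
  shows "quad_error f = quad_error g"
proof -
  have "integral ref_cube f = integral ref_cube g"
    by (intro integral_cong assms)
  moreover have "gauss_quad 4 f = gauss_quad 4 g"
    unfolding gauss_quad_def using assms gauss_points4_ref_cube by (intro sum.cong) auto
  ultimately show ?thesis by (simp add: quad_error_def)
qed

definition triple_error :: "nat^3 \<Rightarrow> nat^3 \<Rightarrow> nat^3 \<Rightarrow> real" where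
  "triple_error m n l =
     quad_error (\<lambda>\<xi>. triple (monomial_grad m \<xi>) (monomial_grad n \<xi>) (monomial_grad l \<xi>))"

lemma continuous_on_triple_grad:
  "continuous_on S (\<lambda>\<xi>. triple (monomial_grad m \<xi>) (monomial_grad n \<xi>) (monomial_grad l \<xi>))"
  unfolding triple_eq by (intro continuous_on_add continuous_on_mult continuous_on_diff continuous_on_monomial_grad)

text \<open>The defect is trilinear in the coefficients, so exactness is decided by the errors on
  triples of monomials.\<close>

lemma quad_defect_polynomial:
  assumes fin: "finite M" "finite K" "finite L"
    and w: "\<And>\<eta> i. \<eta> \<in> ref_cube \<Longrightarrow> w \<eta> $ i = (\<Sum>m\<in>M. a i m * monomial m \<eta>)"
    and u: "\<And>\<eta> i. \<eta> \<in> ref_cube \<Longrightarrow> u \<eta> $ i = (\<Sum>m\<in>K. b i m * monomial m \<eta>)"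
    and v: "\<And>\<eta> i. \<eta> \<in> ref_cube \<Longrightarrow> v \<eta> $ i = (\<Sum>m\<in>L. c i m * monomial m \<eta>)"
  shows "quad_defect w u v = (\<Sum>(m, n, l)\<in>M \<times> K \<times> L.
    (a 1 m * (b 2 n * c 3 l - b 3 n * c 2 l) + a 2 m * (b 3 n * c 1 l - b 1 n * c 3 l)
     + a 3 m * (b 1 n * c 2 l - b 2 n * c 1 l)) * triple_error m n l)"
proof -
  let ?t = "\<lambda>m n l \<xi>. triple (monomial_grad m \<xi>) (monomial_grad n \<xi>) (monomial_grad l \<xi>)"
  let ?c = "\<lambda>(m, n, l). a 1 m * (b 2 n * c 3 l - b 3 n * c 2 l) + a 2 m * (b 3 n * c 1 l - b 1 n * c 3 l)
     + a 3 m * (b 1 n * c 2 l - b 2 n * c 1 l)"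
  have "quad_defect w u v = quad_error (\<lambda>\<xi>. \<Sum>x\<in>M \<times> K \<times> L. ?c x * (case x of (m, n, l) \<Rightarrow> ?t m n l) \<xi>)"
    unfolding quad_defect_def quad_error_def[symmetric]
  proof (rule quad_error_cong)
    fix \<xi> assume \<xi>: "\<xi> \<in> ref_cube"
    have D: "parent_D w \<xi> $ i = (\<Sum>m\<in>M. a i m *\<^sub>R monomial_grad m \<xi>)"
      "parent_D u \<xi> $ i = (\<Sum>m\<in>K. b i m *\<^sub>R monomial_grad m \<xi>)"
      "parent_D v \<xi> $ i = (\<Sum>m\<in>L. c i m *\<^sub>R monomial_grad m \<xi>)" for i
      by (rule parent_D_polynomial[OF _ \<xi>], erule w u v)+
    show "parent_D w \<xi> :\<cdot> (parent_D u \<xi> \<times>\<^sub>M parent_D v \<xi>)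
        = (\<Sum>x\<in>M \<times> K \<times> L. ?c x * (case x of (m, n, l) \<Rightarrow> ?t m n l) \<xi>)"
      unfolding mdot_mcross D triple_sum sum_subtractf[symmetric] sum.distrib[symmetric]
      by (intro sum.cong refl) (auto simp: algebra_simps)
  qed
  also have "\<dots> = (\<Sum>x\<in>M \<times> K \<times> L. ?c x * quad_error (case x of (m, n, l) \<Rightarrow> ?t m n l))"
    by (rule quad_error_sum) (use fin in \<open>auto intro: continuous_on_triple_grad\<close>)
  also have "\<dots> = (\<Sum>(m, n, l)\<in>M \<times> K \<times> L. ?c (m, n, l) * triple_error m n l)"
    by (intro sum.cong refl) (auto simp: triple_error_def)
  finally show ?thesis by simp
qed

definition real_vec :: "nat^3 \<Rightarrow> real^3" where "real_vec m = (\<chi> i. real (m$i))"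

text \<open>For \<open>a = 0\<close> the exponents on the two sides may differ, but the factor
  \<open>real a\<close> vanishes.\<close>

lemma power_pred_mult: "real a * x^(a - 1) * (x^b * x^c) = real a * x^(a + b + c - 1)"
  by (cases a) (simp_all add: power_add)

text \<open>If the truncated exponent of a coordinate is junk, the corresponding column of the
  determinant vanishes.\<close>

lemma triple_grad:
  "triple (monomial_grad m x) (monomial_grad n x) (monomial_grad l x)
    = triple (real_vec m) (real_vec n) (real_vec l) * monomial (\<chi> i. m$i + n$i + l$i - 1) x"
proof -
  \<comment> \<open>One of the six products in the determinant, with the powers of each coordinate
    collected; the other five are instances with the three exponent vectors permuted.\<close>
  have perm: "(real a * x1^(a-1) * x2^a' * x3^a'') * ((x1^b * (real b' * x2^(b'-1)) * x3^b'') * (x1^c * x2^c' * (real c'' * x3^(c''-1))))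
      = real a * real b' * real c'' * (x1^(a+b+c-1) * x2^(a'+b'+c'-1) * x3^(a''+b''+c''-1))"
    for a b c a' b' c' a'' b'' c'' :: nat and x1 x2 x3 :: real
  proof -
    have "(real a * x1^(a-1) * x2^a' * x3^a'') * ((x1^b * (real b' * x2^(b'-1)) * x3^b'') * (x1^c * x2^c' * (real c'' * x3^(c''-1))))
       = (real a * x1^(a-1) * (x1^b * x1^c)) * (real b' * x2^(b'-1) * (x2^a' * x2^c')) * (real c'' * x3^(c''-1) * (x3^a'' * x3^b''))"
      by (simp add: ac_simps)
    also have "\<dots> = (real a * x1^(a+b+c-1)) * (real b' * x2^(b'+a'+c'-1)) * (real c'' * x3^(c''+a''+b''-1))"
      by (simp only: power_pred_mult)
    also have "\<dots> = real a * real b' * real c'' * (x1^(a+b+c-1) * x2^(a'+b'+c'-1) * x3^(a''+b''+c''-1))"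
      by (simp add: ac_simps)
    finally show ?thesis .
  qed
  note p = perm[where ?x1.0 = "x$1" and ?x2.0 = "x$2" and ?x3.0 = "x$3"]
  \<comment> \<open>Each product lists its factors by the coordinate that is differentiated, which
    is the pattern of \<open>perm\<close>.\<close>
  have "triple (monomial_grad m x) (monomial_grad n x) (monomial_grad l x) =
      monomial_grad m x $1 * (monomial_grad n x $2 * monomial_grad l x $3)
    - monomial_grad m x $1 * (monomial_grad l x $2 * monomial_grad n x $3)
    + monomial_grad l x $1 * (monomial_grad m x $2 * monomial_grad n x $3)
    - monomial_grad n x $1 * (monomial_grad m x $2 * monomial_grad l x $3)
    + monomial_grad n x $1 * (monomial_grad l x $2 * monomial_grad m x $3)
    - monomial_grad l x $1 * (monomial_grad n x $2 * monomial_grad m x $3)"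
    by (simp add: triple_eq algebra_simps)
  also have "\<dots> = triple (real_vec m) (real_vec n) (real_vec l) * monomial (\<chi> i. m$i + n$i + l$i - 1) x"
    unfolding monomial_grad_def vector_3 p
    by (simp add: triple_eq real_vec_def monomial_eq add_ac) (simp add: algebra_simps)
  finally show ?thesis .
qed

text \<open>Two independent ways for the error to vanish become visible: linearly dependent exponent
  vectors, or a product monomial that the rule integrates exactly.\<close>

lemma triple_error_eq:
  "triple_error m n l
    = triple (real_vec m) (real_vec n) (real_vec l) * quad_error (monomial (\<chi> i. m$i + n$i + l$i - 1))"
  unfolding triple_error_def triple_grad
  \<comment> \<open>A sum over a one-element index set extracts the scalar factor.\<close>
  using quad_error_sum[of "{()}" "\<lambda>_. monomial (\<chi> i. m$i + n$i + l$i - 1)" "\<lambda>_. triple (real_vec m) (real_vec n) (real_vec l)"]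
  by (simp add: continuous_on_monomial)

section \<open>Matrix calculus and the Hessian of the isochoric energy\<close>

lemma mdot_inner: "A :\<cdot> B = A \<bullet> B"
  by (simp add: mdot_def trace_def transpose_def matrix_matrix_mult_def inner_vec_def sum_3)

lemma bounded_bilinear_mcross: "bounded_bilinear (\<times>\<^sub>M)"
proof -
  have "linear (\<lambda>B. A \<times>\<^sub>M B)" "linear (\<lambda>B. B \<times>\<^sub>M A)" for A
    by (rule linearI; simp add: mcross_def cof_def vec_eq_iff forall_3 algebra_simps)+
  then show ?thesis
    by (simp add: bilinear_conv_bounded_bilinear[symmetric] bilinear_def)
qed

lemma mcross_self: "H \<times>\<^sub>M H = 2 *\<^sub>R cof H"
  by (simp add: mcross_def cof_def vec_eq_iff forall_3)

text \<open>\<open>cof\<close> is the quadratic map whose polarisation is the cross product, by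
  \<open>mcross_self\<close>.\<close>

lemma has_derivative_cof: "(cof has_derivative (\<lambda>k. y \<times>\<^sub>M k)) (at y within S)"
proof -
  have sym: "k \<times>\<^sub>M y = y \<times>\<^sub>M k" for k by (simp add: mcross_def add.commute)
  have "((\<lambda>y. (1/2) *\<^sub>R (y \<times>\<^sub>M y)) has_derivative (\<lambda>k. (1/2) *\<^sub>R (y \<times>\<^sub>M k + k \<times>\<^sub>M y))) (at y within S)"
    by (intro has_derivative_scaleR_right bounded_bilinear.FDERIV[OF bounded_bilinear_mcross] has_derivative_ident)
  then show ?thesis by (simp add: mcross_self sym flip: scaleR_2)
qed

lemma has_derivative_det3: "(det has_derivative (\<lambda>k. cof y \<bullet> k)) (at y within S)" for y :: "real^3^3"
proof -
  have c: "((\<lambda>x::real^3^3. x$i$j) has_derivative (\<lambda>h. h$i$j)) (at y within S)" for i j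
    by (intro bounded_linear_imp_has_derivative bounded_linear_compose[OF bounded_linear_vec_nth bounded_linear_vec_nth])
  show ?thesis
    unfolding det_3[abs_def]
    by (rule derivative_eq_intros c refl)+
      (simp add: inner_vec_def sum_3 cof_def algebra_simps)
qed

lemma has_derivative_det_powr:
  fixes y :: "real^3^3"
  assumes "det y > 0"
  shows "((\<lambda>y. det y powr r) has_derivative (\<lambda>k. r * det y powr (r - 1) * (cof y \<bullet> k))) (at y)"
  using has_derivative_compose[OF has_derivative_det3
    has_real_derivative_powr[OF assms, of r, unfolded has_field_derivative_def]] .

section \<open>First and second derivatives of the isochoric energy\<close>

definition W_deriv :: "real \<Rightarrow> real \<Rightarrow> real^3^3 \<Rightarrow> real^3^3 \<Rightarrow> real" where
  "W_deriv c1 c2 y k =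
     c1 * (det y powr (-2/3) * (2 * (y \<bullet> k)) + (-2/3) * det y powr (-2/3 - 1) * (cof y \<bullet> k) * (y \<bullet> y))
   + c2 * (det y powr (-4/3) * (2 * (cof y \<bullet> (y \<times>\<^sub>M k)))
       + (-4/3) * det y powr (-4/3 - 1) * (cof y \<bullet> k) * (cof y \<bullet> cof y))"

lemma has_derivative_W_iso:
  assumes "det y > 0"
  shows "(W_iso c1 c2 has_derivative W_deriv c1 c2 y) (at y)"
  unfolding W_iso_def[abs_def] mdot_inner
  by (rule derivative_eq_intros has_derivative_det_powr[OF assms] has_derivative_cof refl)+
    (auto simp: W_deriv_def fun_eq_iff algebra_simps inner_commute)

lemma cof_mat1: "cof (mat 1) = mat 1"
  by (simp add: cof_def vec_eq_iff forall_3 mat_def)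

lemma inner_mat1: "mat 1 \<bullet> H = trace H" for H :: "real^3^3"
  by (simp add: trace_def inner_vec_def sum_3 mat_def)

lemma mcross_mat1: "mat 1 \<times>\<^sub>M H = trace H *\<^sub>R mat 1 - transpose H"
  by (simp add: mcross_def cof_def vec_eq_iff forall_3 mat_def transpose_def trace_def sum_3 algebra_simps)

lemma trace_mcross_mat1: "trace (mat 1 \<times>\<^sub>M H) = 2 * trace H"
  unfolding mcross_mat1 by (simp add: trace_def sum_3 mat_def transpose_def)

lemma trace_mcross_self: "trace (H \<times>\<^sub>M H) = (trace H)^2 - trace (H ** H)"
  by (simp add: mcross_self cof_def trace_def sum_3 matrix_matrix_mult_def algebra_simps power2_eq_square)

lemma inner_mcross_mat1: "(mat 1 \<times>\<^sub>M H) \<bullet> K = trace H * trace K - trace (H ** K)" for H K :: "real^3^3"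
  unfolding mcross_mat1 by (simp add: trace_def inner_vec_def sum_3 mat_def transpose_def matrix_matrix_mult_def algebra_simps)

lemma inner_mcross_mcross_mat1:
  "(mat 1 \<times>\<^sub>M H) \<bullet> (mat 1 \<times>\<^sub>M H) = (trace H)^2 + H \<bullet> H"
  unfolding mcross_mat1 by (simp add: trace_def inner_vec_def sum_3 mat_def transpose_def algebra_simps power2_eq_square)

text \<open>At the identity every power of the determinant is 1, the cofactor matrix is the identity
  and both squared norms are 3. The factors -5/3 and -7/3 are the exponents left after the first
  differentiation. The sum stays in the shape in which the product rules deliver it.\<close>

lemma has_derivative_W_deriv:
  "((\<lambda>y. W_deriv c1 c2 y k) has_derivative (\<lambda>h.
      c1 * ((2 * (h \<bullet> k) - 2/3 * trace h * (2 * trace k))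
        - 2/3 * (-5/3 * trace h * trace k * 3 + ((mat 1 \<times>\<^sub>M h) \<bullet> k) * 3 + trace k * (2 * trace h)))
    + c2 * ((2 * ((mat 1 \<times>\<^sub>M h) \<bullet> (mat 1 \<times>\<^sub>M k) + trace (h \<times>\<^sub>M k)) - 4/3 * trace h * (4 * trace k))
        - 4/3 * (-7/3 * trace h * trace k * 3 + ((mat 1 \<times>\<^sub>M h) \<bullet> k) * 3 + trace k * (4 * trace h))))) (at (mat 1))"
proof -
  have d: "det (mat 1 :: real^3^3) > 0" by simp
  have t: "trace (mat 1 :: real^3^3) = 3" by (simp add: trace_def sum_3 mat_def)
  have m1: "H \<bullet> mat 1 = trace H" for H :: "real^3^3" by (metis inner_commute inner_mat1)
  have mc: "((\<lambda>y. y \<times>\<^sub>M k) has_derivative (\<lambda>h. h \<times>\<^sub>M k)) (at (mat 1))"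
    by (rule bounded_linear_imp_has_derivative bounded_bilinear.bounded_linear_left[OF bounded_bilinear_mcross])+
  show ?thesis
    unfolding W_deriv_def[abs_def]
    by (rule derivative_eq_intros has_derivative_det_powr[OF d] has_derivative_cof mc refl)+
      (simp add: fun_eq_iff cof_mat1 inner_mat1 m1 t trace_mcross_mat1 algebra_simps)
qed

text \<open>Both energies have the same Hessian at the identity, namely 4 times the squared norm of
  the deviatoric symmetric part of \<open>H\<close>; hence only \<open>c1 + c2\<close>
  enters.\<close>

lemma hess_iso_eq:
  "hess_iso c1 c2 H H = (c1 + c2) * (2 * (H \<bullet> H) + 2 * trace (H ** H) - 4/3 * (trace H)^2)"
proof -
  let ?V = "\<lambda>y. frechet_derivative (W_iso c1 c2) (at y) H"
  let ?U = "{y :: real^3^3. 0 < det y}"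
  have "continuous_on UNIV (det :: real^3^3 \<Rightarrow> real)"
    unfolding det_3[abs_def] by (intro continuous_intros)
  \<comment> \<open>The formula for the first derivative holds only where the determinant is
    positive, so it is differentiated again within this open neighbourhood of the identity.\<close>
  then have U: "open ?U" by (intro open_Collect_less) auto
  have V: "W_deriv c1 c2 y H = ?V y" if "y \<in> ?U" for y
    using frechet_derivative_at[OF has_derivative_W_iso] that by auto
  have "(?V has_derivative (\<lambda>h.
      c1 * ((2 * (h \<bullet> H) - 2/3 * trace h * (2 * trace H))
        - 2/3 * (-5/3 * trace h * trace H * 3 + ((mat 1 \<times>\<^sub>M h) \<bullet> H) * 3 + trace H * (2 * trace h)))
    + c2 * ((2 * ((mat 1 \<times>\<^sub>M h) \<bullet> (mat 1 \<times>\<^sub>M H) + trace (h \<times>\<^sub>M H)) - 4/3 * trace h * (4 * trace H))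
        - 4/3 * (-7/3 * trace h * trace H * 3 + ((mat 1 \<times>\<^sub>M h) \<bullet> H) * 3 + trace H * (4 * trace h))))) (at (mat 1))"
    by (rule has_derivative_transform_within_open[OF has_derivative_W_deriv U]) (auto simp: V)
  from fun_cong[OF frechet_derivative_at[OF this], of H] show ?thesis
    unfolding hess_iso_def second_derivative_def inner_mcross_mcross_mat1
    unfolding inner_mcross_mat1 trace_mcross_self
    by (simp add: algebra_simps power2_eq_square)
qed

lemma inner_33: "A \<bullet> B = A$1$1*B$1$1 + A$1$2*B$1$2 + A$1$3*B$1$3 + A$2$1*B$2$1 + A$2$2*B$2$2 + A$2$3*B$2$3
    + A$3$1*B$3$1 + A$3$2*B$3$2 + A$3$3*B$3$3" for A B :: "real^3^3"
  by (simp add: inner_vec_def sum_3)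

lemma hess_iso_nonneg:
  assumes "c1 + c2 \<ge> 0"
  shows "hess_iso c1 c2 H H \<ge> 0"
proof -
  \<comment> \<open>The deviatoric symmetric part as squares: sums of opposite off-diagonal entries
    and differences of diagonal entries.\<close>
  have "2 * (H \<bullet> H) + 2 * trace (H ** H) - 4/3 * (trace H)^2
     = 2 * ((H$1$2 + H$2$1)^2 + (H$1$3 + H$3$1)^2 + (H$2$3 + H$3$2)^2)
     + 4/3 * ((H$1$1 - H$2$2)^2 + (H$1$1 - H$3$3)^2 + (H$2$2 - H$3$3)^2)"
    by (simp add: inner_33 trace_def sum_3 matrix_matrix_mult_def algebra_simps power2_eq_square)
  then have "2 * (H \<bullet> H) + 2 * trace (H ** H) - 4/3 * (trace H)^2 \<ge> 0" by simp
  then show ?thesis using assms by (simp add: hess_iso_eq)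
qed

lemma A_form_eq: "A_form H H = 2 * (H \<bullet> H) + 2/3 * (trace H)^2"
  by (simp add: A_form_def mdot_inner power2_eq_square)

lemma A_form_ge: "A_form H H \<ge> 2 * (H \<bullet> H)"
  by (simp add: A_form_eq)

lemma A_form_pos: "H \<noteq> 0 \<Longrightarrow> A_form H H > 0"
  using A_form_ge[of H] by (smt (verit) inner_gt_zero_iff)

text \<open>By \<open>trace_mcross_self\<close> the added term is 2 (c1 + c2) ((tr H)^2 - tr (H H)):
  it cancels the indefinite tr (H H) and turns the coefficient -4/3 of (tr H)^2 into 2/3.\<close>

lemma hess_iso_add_cof:
  "hess_iso c1 c2 H H + (2 * (c1 + c2)) *\<^sub>R mat 1 \<bullet> (H \<times>\<^sub>M H) = (c1 + c2) * A_form H H"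
  unfolding hess_iso_eq A_form_eq inner_scaleR_left inner_mat1 trace_mcross_self
  by (simp add: field_simps)

section \<open>Elementary properties of the margin\<close>

definition margin_ratio :: "real \<Rightarrow> real \<Rightarrow> real^3^3 \<Rightarrow> real^3^3 \<Rightarrow> real" where
  "margin_ratio c1 c2 R H = (hess_iso c1 c2 H H + R :\<cdot> (H \<times>\<^sub>M H)) / A_form H H"

text \<open>The infimum in the margin bounds single ratios only once boundedness is known. The
  Hessian is nonnegative, and the cross term is quadratic in \<open>H\<close>, hence controlled by
  \<open>A_form\<close>.\<close>

lemma bdd_below_margin_ratio:
  assumes "c1 + c2 \<ge> 0"
  shows "bdd_below (margin_ratio c1 c2 R ` (UNIV - {0}))"
proof -
  obtain K where K: "\<And>A B. norm (A \<times>\<^sub>M B) \<le> norm A * norm B * K" "K > 0"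
    using bounded_bilinear.pos_bounded[OF bounded_bilinear_mcross] by blast
  have "- (norm R * K / 2) \<le> margin_ratio c1 c2 R H" if "H \<noteq> 0" for H
  proof -
    have "\<bar>R \<bullet> (H \<times>\<^sub>M H)\<bar> \<le> norm R * (norm H * norm H * K)"
      by (rule order_trans[OF Cauchy_Schwarz_ineq2]) (intro mult_left_mono K norm_ge_zero)
    also have "\<dots> = norm R * K / 2 * (2 * (H \<bullet> H))"
      by (simp add: dot_square_norm power2_eq_square)
    also have "\<dots> \<le> norm R * K / 2 * A_form H H"
      using K(2) by (intro mult_left_mono A_form_ge) auto
    finally have "- (norm R * K / 2) * A_form H H \<le> hess_iso c1 c2 H H + R :\<cdot> (H \<times>\<^sub>M H)"
      using hess_iso_nonneg[OF assms, of H] by (simp add: mdot_inner)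
    then show ?thesis
      using A_form_pos[OF that] by (simp add: margin_ratio_def pos_le_divide_eq)
  qed
  then show ?thesis by (intro bdd_belowI2) auto
qed

lemma finite_cells: "finite (cells N)"
proof -
  have "cells N \<subseteq> (\<lambda>(a, b, c). vector [a, b, c]) ` ({..<N} \<times> {..<N} \<times> {..<N})"
  proof
    fix m :: "nat^3" assume m: "m \<in> cells N"
    have "m = vector [m$1, m$2, m$3]" by (simp add: vec_eq_iff forall_3)
    then show "m \<in> (\<lambda>(a, b, c). vector [a, b, c]) ` ({..<N} \<times> {..<N} \<times> {..<N})"
      using m by (intro image_eqI[of _ _ "(m$1, m$2, m$3)"]) (auto simp: cells_def)
  qed
  then show ?thesis by (rule finite_subset) simp
qed

lemma margin_eq:
  "margin N \<alpha> c1 c2 z = Min ((\<lambda>(e, \<xi>). INF H\<in>UNIV - {0}.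
      margin_ratio (c1 e) (c2 e) (R_field N \<alpha> z e \<xi>) H) ` (cells N \<times> gauss_points 4))"
  by (simp add: margin_def margin_ratio_def)

lemma margin_le:
  assumes "material N c c1 c2" "e \<in> cells N" "\<xi> \<in> gauss_points 4" "H \<noteq> 0"
  shows "margin N \<alpha> c1 c2 z \<le> margin_ratio (c1 e) (c2 e) (R_field N \<alpha> z e \<xi>) H"
proof -
  have "c1 e + c2 e \<ge> 0" using assms by (simp add: material_def)
  then have "(INF H\<in>UNIV - {0}. margin_ratio (c1 e) (c2 e) (R_field N \<alpha> z e \<xi>) H)
      \<le> margin_ratio (c1 e) (c2 e) (R_field N \<alpha> z e \<xi>) H"
    using assms(4) by (intro cINF_lower bdd_below_margin_ratio) auto
  moreover have "margin N \<alpha> c1 c2 z \<le> (INF H\<in>UNIV - {0}. margin_ratio (c1 e) (c2 e) (R_field N \<alpha> z e \<xi>) H)"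
    unfolding margin_eq using assms
    by (intro Min_le) (auto simp: finite_cells finite_gauss_points4 intro!: image_eqI[of _ _ "(e, \<xi>)"])
  ultimately show ?thesis by simp
qed

lemma gauss_points4_nonempty: "gauss_points 4 \<noteq> {}"
proof -
  have "(\<chi> i. gl_out) \<in> gauss_points 4" by (simp add: gauss_points_def gauss_nodes4)
  then show ?thesis by blast
qed

lemma zero_in_cells: "N \<ge> 1 \<Longrightarrow> 0 \<in> cells N"
  by (simp add: cells_def)

lemma margin_ge:
  assumes "N \<ge> 1"
    "\<And>e \<xi> H. e \<in> cells N \<Longrightarrow> \<xi> \<in> gauss_points 4 \<Longrightarrow> H \<noteq> 0 \<Longrightarrow>
       m \<le> margin_ratio (c1 e) (c2 e) (R_field N \<alpha> z e \<xi>) H"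
  shows "m \<le> margin N \<alpha> c1 c2 z"
proof -
  \<comment> \<open>A witness that the infimum ranges over a nonempty set.\<close>
  have "(mat 1 :: real^3^3) \<noteq> 0" by (simp add: mat_def vec_eq_iff)
  then have "(UNIV :: (real^3^3) set) - {0} \<noteq> {}" by blast
  then show ?thesis
    unfolding margin_eq using assms zero_in_cells[OF assms(1)] gauss_points4_nonempty
    by (subst Min_ge_iff) (auto simp: finite_cells finite_gauss_points4 intro!: cINF_greatest)
qed

text \<open>A rank-one matrix has zero cofactor, so \<open>R\<close> drops out. This caps every
  margin by \<open>c\<close>.\<close>

lemma margin_ratio_shear:
  "margin_ratio c1 c2 R (axis 1 (axis 2 1)) = c1 + c2"
proof -
  let ?H = "axis 1 (axis 2 1) :: real^3^3"
  have "(axis 2 1 :: real^3) $ 1 = 0" "(axis 2 1 :: real^3) $ 3 = 0" by (simp_all add: axis_def)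
  note [simp] = this
  have H: "?H$i$j = (if i = 1 \<and> j = 2 then 1 else 0)" for i j
    using exhaust_3[of j] by (auto simp: axis_def)
  have "cof ?H = 0" by (simp add: cof_def vec_eq_iff forall_3 H)
  moreover have "?H \<bullet> ?H = 1" "trace ?H = 0" "trace (?H ** ?H) = 0"
    by (simp_all add: inner_33 H trace_def sum_3 matrix_matrix_mult_def)
  ultimately show ?thesis
    by (simp add: margin_ratio_def mdot_inner mcross_self hess_iso_eq A_form_eq)
qed

lemma material_sum: "material N c c1 c2 \<Longrightarrow> e \<in> cells N \<Longrightarrow> c1 e + c2 e = c"
  by (simp add: material_def)

lemma margin_le_c:
  assumes "N \<ge> 1" "material N c c1 c2"
  shows "margin N \<alpha> c1 c2 z \<le> c"
proof -
  obtain \<xi> where "\<xi> \<in> gauss_points 4" using gauss_points4_nonempty by blast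
  moreover have "axis 1 (axis 2 1) \<noteq> (0 :: real^3^3)" by (simp add: axis_eq_0_iff)
  ultimately show ?thesis
    using margin_le[OF assms(2) zero_in_cells[OF assms(1)], of \<xi> "axis 1 (axis 2 1)"]
      material_sum[OF assms(2) zero_in_cells[OF assms(1)]]
    by (simp add: margin_ratio_shear)
qed

section \<open>Exactness of the Gauss rule on the potentials\<close>

definition m311 :: "nat^3" where "m311 = vector [3, 1, 1]"

lemma m311_nth [simp]: "m311 $ 1 = 3" "m311 $ 2 = 1" "m311 $ 3 = 1"
  by (simp_all add: m311_def)

lemma S3_exps_iff:
  "m \<in> S3_exps \<longleftrightarrow> (if m$1 \<ge> 2 then m$1 else 0) + (if m$2 \<ge> 2 then m$2 else 0) + (if m$3 \<ge> 2 then m$3 else 0) \<le> 3"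
proof -
  have "(\<Sum>i | m$i \<ge> 2. m$i) = (\<Sum>i\<in>UNIV. if m$i \<ge> 2 then m$i else 0)"
    using sum.inter_filter[of "UNIV :: 3 set" "\<lambda>i. m$i" "\<lambda>i. m$i \<ge> 2"] by simp
  then show ?thesis by (simp add: S3_exps_def sum_3)
qed

lemma S3_exps_members: "0 \<in> S3_exps" "axis i 1 \<in> S3_exps" "m311 \<in> S3_exps"
  using exhaust_3[of i] by (auto simp: S3_exps_iff axis_def)

text \<open>The degree in each coordinate is at most 2 + 3 + 3 - 1 = 7, just within the exactness of
  the rule.\<close>

lemma triple_error_low:
  assumes "\<And>i. m$i \<le> 2" "n \<in> Q3_exps" "l \<in> Q3_exps"
  shows "triple_error m n l = 0"
proof -
  have "m$i + n$i + l$i - 1 \<le> 7" for i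
  proof -
    have "m$i \<le> 2" "n$i \<le> 3" "l$i \<le> 3" using assms by (auto simp: Q3_exps_def)
    then show ?thesis by linarith
  qed
  then have "quad_error (monomial (\<chi> i. m$i + n$i + l$i - 1)) = 0"
    by (intro quad_error_monomial_exact) simp
  then show ?thesis by (simp add: triple_error_eq)
qed

text \<open>Only an exponent 8 of the first coordinate could spoil exactness; it forces
  \<open>n$1 = l$1 = 3\<close>, and then \<open>n = l\<close> or the error is odd in another coordinate.\<close>

lemma triple_error_m311_S3:
  assumes n: "n \<in> S3_exps" and l: "l \<in> S3_exps"
  shows "triple_error m311 n l = 0"
proof -
  have le3: "n$i \<le> 3" "l$i \<le> 3" for i
    using n l S3_exps_subset_Q3_exps by (auto simp: Q3_exps_def)
  let ?k = "\<chi> i. m311$i + n$i + l$i - 1 :: nat^3"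
  have k: "?k$1 = n$1 + l$1 + 2" "?k$2 = n$2 + l$2" "?k$3 = n$3 + l$3" by simp_all
  show ?thesis
  proof (cases "n$1 + l$1 \<le> 5")
    case True
    then have "\<forall>i. ?k$i \<le> 7 \<or> odd (?k$i)"
      unfolding forall_3 k using le3[of 2] le3[of 3] by linarith
    then show ?thesis unfolding triple_error_eq by (subst quad_error_monomial_exact) auto
  next
    case False
    then have e: "n$1 = 3" "l$1 = 3" using le3[of 1] by linarith+
    \<comment> \<open>The exponent 3 exhausts the superlinear degree allowed in
      \<open>S3_exps\<close>; the remaining exponents are 0 or 1, so equal parity will mean
      equality.\<close>
    then have small: "n$2 \<le> 1" "n$3 \<le> 1" "l$2 \<le> 1" "l$3 \<le> 1"
      using n l by (auto simp: S3_exps_iff split: if_splits)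
    show ?thesis
    proof (cases "odd (n$2 + l$2) \<or> odd (n$3 + l$3)")
      case True
      then have "odd (?k$2) \<or> odd (?k$3)" unfolding k .
      then have "quad_error (monomial ?k) = 0" using quad_error_monomial_odd by blast
      then show ?thesis by (simp add: triple_error_eq)
    next
      case False
      then have "n$2 = l$2" "n$3 = l$3" using small by presburger+
      then have "n = l" using e by (simp add: vec_eq_iff forall_3)
      then show ?thesis by (simp add: triple_error_eq triple_eq)
    qed
  qed
qed

text \<open>Constant, linear and perturbation coefficients of component \<open>i\<close>. With
  \<alpha> = 0 they describe the affine cell map.\<close>

definition geom_coeff :: "nat \<Rightarrow> real \<Rightarrow> nat^3 \<Rightarrow> 3 \<Rightarrow> nat^3 \<Rightarrow> real" where
  "geom_coeff N \<alpha> e i m = (if m = 0 then 1 / real N / 2 * (2 * real (e$i) + 1) else 0)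
     + (if m = axis i 1 then 1 / real N / 2 else 0)
     + (if m = m311 then (if i = 1 then 1 / real N * \<alpha> / 2 * cell_sign e else 0) else 0)"

lemma monomial_0 [simp]: "monomial 0 x = 1"
  by (simp add: monomial_def)

lemma monomial_axis [simp]: "monomial (axis i 1) x = x$i"
  using exhaust_3[of i] by (auto simp: monomial_eq axis_def)

lemma monomial_m311: "monomial m311 x = (x$1)^3 * x$2 * x$3"
  by (simp add: monomial_eq)

lemma geom_monomials:
  "geom N \<alpha> e \<eta> $ i = (\<Sum>m\<in>S3_exps. geom_coeff N \<alpha> e i m * monomial m \<eta>)"
proof -
  have "(axis 1 1 :: real^3) $ i = (if i = 1 then 1 else 0)" by (simp add: axis_def)
  then show ?thesis
    unfolding geom_coeff_def distrib_right sum.distrib if_distrib[of "\<lambda>a. a * _"] mult_zero_left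
    by (simp add: sum.delta finite_S3_exps S3_exps_members monomial_m311 geom_def cell_map_def algebra_simps del: One_nat_def)
qed

lemma cell_map_eq_geom: "cell_map N e = geom N 0 e"
  by (simp add: geom_def fun_eq_iff)

lemma scaled_geom_monomials:
  "(k *\<^sub>R geom N \<alpha> e \<eta>) $ i = (\<Sum>m\<in>S3_exps. (k * geom_coeff N \<alpha> e i m) * monomial m \<eta>)"
  by (simp add: geom_monomials sum_distrib_left mult.assoc)

lemma scaled_geom_span: "(\<lambda>\<eta>. k *\<^sub>R geom N \<alpha> e \<eta>) \<in> vector_span S3_exps"
  unfolding vector_span_def monomial_span_def by (intro CollectI allI exI) (rule scaled_geom_monomials)

text \<open>Serves both explicit potentials: the identity field tested against
  \<open>S3_exps\<close>, and, with \<alpha> = 0, the inverse field tested against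
  \<open>Q3_exps\<close>. The constant and linear monomials are always exact, which leaves only
  \<open>m311\<close> to \<open>top\<close>.\<close>

lemma quad_defect_geom:
  assumes w: "\<And>\<eta>. \<eta> \<in> ref_cube \<Longrightarrow> w \<eta> = k *\<^sub>R geom N \<alpha> e \<eta>"
    and M: "M \<subseteq> Q3_exps" "u \<in> vector_span M" "v \<in> vector_span M"
    and top: "\<alpha> = 0 \<or> (\<forall>n\<in>M. \<forall>l\<in>M. triple_error m311 n l = 0)"
  shows "quad_defect w u v = 0"
proof -
  obtain b where b: "\<forall>x i. u x $ i = (\<Sum>m\<in>M. b i m * monomial m x)" using vector_spanD[OF M(2)] by blast
  obtain c where c: "\<forall>x i. v x $ i = (\<Sum>m\<in>M. c i m * monomial m x)" using vector_spanD[OF M(3)] by blast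
  have fM: "finite M" using M(1) finite_Q3_exps by (rule finite_subset)
  let ?a = "\<lambda>i m. k * geom_coeff N \<alpha> e i m"
  have "w \<eta> $ i = (\<Sum>m\<in>S3_exps. ?a i m * monomial m \<eta>)" if "\<eta> \<in> ref_cube" for \<eta> i
    using w[OF that] scaled_geom_monomials by metis
  from quad_defect_polynomial[where a = ?a, OF finite_S3_exps fM fM this b[rule_format] c[rule_format]]
  have "quad_defect w u v = (\<Sum>(m, n, l)\<in>S3_exps \<times> M \<times> M.
    (?a 1 m * (b 2 n * c 3 l - b 3 n * c 2 l) + ?a 2 m * (b 3 n * c 1 l - b 1 n * c 3 l)
     + ?a 3 m * (b 1 n * c 2 l - b 2 n * c 1 l)) * triple_error m n l)" by blast
  also have "\<dots> = 0"
  proof (intro sum.neutral ballI, clarify)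
    fix m n l assume n: "n \<in> M" and l: "l \<in> M"
    have low: "triple_error 0 n l = 0" "triple_error (axis i 1) n l = 0" for i
      by (rule triple_error_low; use n l M(1) in \<open>auto simp: axis_def\<close>)+
    have "?a i m * triple_error m n l = 0" for i
      using low(1) low(2)[of i] top n l by (auto simp: geom_coeff_def)
    then have "?a i m = 0 \<or> triple_error m n l = 0" for i by (metis mult_eq_0_iff)
    then have "triple_error m n l = 0 \<or> (?a 1 m = 0 \<and> ?a 2 m = 0 \<and> ?a 3 m = 0)" by blast
    then show "(?a 1 m * (b 2 n * c 3 l - b 3 n * c 2 l) + ?a 2 m * (b 3 n * c 1 l - b 1 n * c 3 l)
     + ?a 3 m * (b 1 n * c 2 l - b 2 n * c 1 l)) * triple_error m n l = 0"
      by (elim disjE conjE) (simp_all only: mult_zero_left mult_zero_right add_0_left)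
  qed
  finally show ?thesis .
qed

lemma identity_in_Z_S: "(\<lambda>x. k *\<^sub>R x) \<in> Z_S N \<alpha>"
  unfolding exact_class_def candidates_def
proof (intro CollectI conjI ballI)
  show "continuous_on (closure (domain_h N \<alpha>)) (\<lambda>x. k *\<^sub>R x)" by (intro continuous_intros)
  show "\<exists>p\<in>vector_span S3_exps. \<forall>\<xi>\<in>ref_cube. k *\<^sub>R geom N \<alpha> e \<xi> = p \<xi>" for e
    by (rule bexI[of _ "\<lambda>\<eta>. k *\<^sub>R geom N \<alpha> e \<eta>"]) (simp_all add: scaled_geom_span)
  show "quad_defect (\<lambda>\<xi>. k *\<^sub>R geom N \<alpha> e \<xi>) u v = 0"
    if "u \<in> vector_span S3_exps" "v \<in> vector_span S3_exps" for e u v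
    using quad_defect_geom[OF refl S3_exps_subset_Q3_exps that] triple_error_m311_S3 by blast
qed

section \<open>The Jacobian of the cell maps\<close>

text \<open>The matrix I + e_1 v^T; up to a scalar every cell Jacobian has this form.\<close>

definition shear :: "real^3 \<Rightarrow> real^3^3" where
  "shear v = mat 1 + (\<chi> i. if i = 1 then v else 0)"

lemma shear_nth: "shear v $ i $ j = (if i = j then 1 else 0) + (if i = 1 then v$j else 0)"
  by (simp add: shear_def mat_def)

lemma shear_mult: "shear v ** shear w = shear (v + w + v$1 *\<^sub>R w)"
  by (simp add: vec_eq_iff forall_3 matrix_matrix_mult_def sum_3 shear_nth algebra_simps)

text \<open>The Sherman-Morrison formula for I + e_1 v^T, whose determinant is
  \<open>1 + v$1\<close>.\<close>

lemma shear_inverse: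
  assumes "1 + v$1 \<noteq> 0"
  shows "shear v ** shear (- (1 / (1 + v$1)) *\<^sub>R v) = mat 1"
    "shear (- (1 / (1 + v$1)) *\<^sub>R v) ** shear v = mat 1"
proof -
  let ?d = "1 / (1 + v$1)"
  have "?d + v$1 * ?d = (1 + v$1) * ?d" by (simp only: distrib_right mult_1)
  then have d: "?d + v$1 * ?d = 1" using assms by simp
  have 0: "shear 0 = mat 1" by (simp add: vec_eq_iff shear_nth mat_def)
  have "v + - ?d *\<^sub>R v + v$1 *\<^sub>R (- ?d *\<^sub>R v) = (1 - (?d + v$1 * ?d)) *\<^sub>R v"
    by (simp only: scaleR_scaleR scaleR_left_diff_distrib scaleR_add_left scaleR_one) simp
  then show "shear v ** shear (- ?d *\<^sub>R v) = mat 1"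
    unfolding shear_mult d by (simp add: 0)
  have "- ?d *\<^sub>R v + v + (- ?d *\<^sub>R v)$1 *\<^sub>R v = (1 - (?d + v$1 * ?d)) *\<^sub>R v"
    by (simp add: scaleR_left_diff_distrib scaleR_add_left mult.commute)
  then show "shear (- ?d *\<^sub>R v) ** shear v = mat 1"
    unfolding shear_mult d by (simp add: 0)
qed

text \<open>The gradient of the perturbation of the first component, divided by h/2, so that the
  cell Jacobian is h/2 times \<open>shear (bump \<alpha> e \<xi>)\<close>.\<close>

definition bump :: "real \<Rightarrow> nat^3 \<Rightarrow> real^3 \<Rightarrow> real^3" where
  "bump \<alpha> e \<xi> = (\<alpha> * cell_sign e) *\<^sub>R monomial_grad m311 \<xi>"

lemma bump_nth:
  "bump \<alpha> e \<xi> $ 1 = \<alpha> * cell_sign e * (3 * (\<xi>$1)^2 * \<xi>$2 * \<xi>$3)"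
  "bump \<alpha> e \<xi> $ 2 = \<alpha> * cell_sign e * ((\<xi>$1)^3 * \<xi>$3)"
  "bump \<alpha> e \<xi> $ 3 = \<alpha> * cell_sign e * ((\<xi>$1)^3 * \<xi>$2)"
  by (simp_all add: bump_def monomial_grad_def)

lemma cell_sign_abs: "\<bar>cell_sign e\<bar> = 1"
  by (simp add: cell_sign_def power_abs)

lemma ref_cube_abs: "\<xi> \<in> ref_cube \<Longrightarrow> \<bar>\<xi>$i\<bar> \<le> 1"
  by (simp add: ref_cube_def mem_box_cart abs_le_iff minus_le_iff)

lemma bump_1_bound:
  assumes "\<xi> \<in> ref_cube"
  shows "\<bar>bump \<alpha> e \<xi> $ 1\<bar> \<le> 3 * \<bar>\<alpha>\<bar>"
proof -
  have "\<bar>(\<xi>$1)^2 * \<xi>$2 * \<xi>$3\<bar> \<le> 1 * 1 * 1"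
    unfolding abs_mult power_abs using ref_cube_abs[OF assms]
    by (intro mult_mono) (auto intro: power_le_one simp: abs_square_le_1)
  then have "\<bar>\<alpha>\<bar> * (3 * \<bar>(\<xi>$1)^2 * \<xi>$2 * \<xi>$3\<bar>) \<le> \<bar>\<alpha>\<bar> * (3 * 1)"
    by (intro mult_left_mono) auto
  then show ?thesis by (simp add: bump_nth abs_mult cell_sign_abs mult_ac)
qed

text \<open>The source of sqrt 11: on the cube the three partial derivatives of the perturbation
  monomial are at most 3, 1 and 1, and 9 + 1 + 1 = 11.\<close>

lemma norm_bump:
  assumes "\<xi> \<in> ref_cube"
  shows "norm (bump \<alpha> e \<xi>) \<le> sqrt 11 * \<bar>\<alpha>\<bar>"
proof -
  have a: "\<bar>\<xi>$1\<bar> \<le> 1" "\<bar>\<xi>$2\<bar> \<le> 1" "\<bar>\<xi>$3\<bar> \<le> 1" using ref_cube_abs[OF assms] by auto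
  have 1: "\<bar>(\<xi>$1)^2 * \<xi>$2 * \<xi>$3\<bar> \<le> 1 * 1 * 1"
    unfolding abs_mult power_abs using a by (intro mult_mono) (auto intro: power_le_one simp: abs_square_le_1)
  have 2: "\<bar>(\<xi>$1)^3 * \<xi>$3\<bar> \<le> 1 * 1" "\<bar>(\<xi>$1)^3 * \<xi>$2\<bar> \<le> 1 * 1"
    unfolding abs_mult power_abs using a by (intro mult_mono; auto intro: power_le_one)+
  have "(norm (monomial_grad m311 \<xi>))^2
      = 9 * ((\<xi>$1)^2 * \<xi>$2 * \<xi>$3)^2 + ((\<xi>$1)^3 * \<xi>$3)^2 + ((\<xi>$1)^3 * \<xi>$2)^2"
    unfolding power2_norm_eq_inner
    by (simp add: monomial_grad_def inner_vec_def sum_3 power2_eq_square)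
  also have "\<dots> \<le> 9 * 1 + 1 + 1"
    using 1 2 by (intro add_mono mult_left_mono) (auto simp: abs_square_le_1)
  finally have "norm (monomial_grad m311 \<xi>) \<le> sqrt 11" by (simp add: real_le_rsqrt)
  then show ?thesis
    by (simp add: bump_def abs_mult cell_sign_abs mult.commute mult_left_mono)
qed

lemma parent_D_scaled_geom:
  assumes f: "\<And>\<eta>. \<eta> \<in> ref_cube \<Longrightarrow> f \<eta> = k *\<^sub>R geom N \<alpha> e \<eta>" and \<xi>: "\<xi> \<in> ref_cube"
  shows "parent_D f \<xi> = (k / real N / 2) *\<^sub>R shear (bump \<alpha> e \<xi>)"
proof -
  have cm: "(cell_map N e has_derivative (\<lambda>h. (1 / real N / 2) *\<^sub>R h)) (at \<xi> within ref_cube)"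
  proof -
    have "cell_map N e = (\<lambda>\<xi>. (1 / real N / 2) *\<^sub>R \<xi> + cell_map N e 0)"
      by (simp add: fun_eq_iff cell_map_def vec_eq_iff algebra_simps)
    moreover have "((\<lambda>\<xi>. (1 / real N / 2) *\<^sub>R \<xi> + cell_map N e 0) has_derivative (\<lambda>h. (1 / real N / 2) *\<^sub>R h)) (at \<xi> within ref_cube)"
      by (auto intro!: derivative_eq_intros)
    ultimately show ?thesis by simp
  qed
  have "((\<lambda>\<eta>. k *\<^sub>R (cell_map N e \<eta> + ((1 / real N * \<alpha> / 2 * cell_sign e) * monomial m311 \<eta>) *\<^sub>R axis 1 1))
    has_derivative (\<lambda>h. k *\<^sub>R ((1 / real N / 2) *\<^sub>R h + ((1 / real N * \<alpha> / 2 * cell_sign e) * (monomial_grad m311 \<xi> \<bullet> h)) *\<^sub>R axis 1 1)))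
     (at \<xi> within ref_cube)"
    by (intro has_derivative_scaleR_right has_derivative_scaleR_left has_derivative_add cm has_derivative_mult_right has_derivative_monomial)
  then have "parent_D f \<xi> = matrix (\<lambda>h. k *\<^sub>R ((1 / real N / 2) *\<^sub>R h + ((1 / real N * \<alpha> / 2 * cell_sign e) * (monomial_grad m311 \<xi> \<bullet> h)) *\<^sub>R axis 1 1))"
    by (rule parent_D_eqI) (simp_all add: f \<xi> geom_def monomial_m311 mult.assoc)
  moreover have "(axis j 1 :: real^3) $ i = (if i = j then 1 else 0)" for i j by (simp add: axis_def)
  ultimately show ?thesis
    by (simp add: matrix_def vec_eq_iff shear_nth bump_def inner_axis algebra_simps)
qed

lemma parent_D_geom:
  "\<xi> \<in> ref_cube \<Longrightarrow> parent_D (geom N \<alpha> e) \<xi> = (1 / real N / 2) *\<^sub>R shear (bump \<alpha> e \<xi>)"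
  by (rule parent_D_scaled_geom) simp_all

lemma matrix_mult_scaleR: "(a *\<^sub>R A) ** (b *\<^sub>R B) = (a * b) *\<^sub>R (A ** B)" for A B :: "real^3^3"
  by (simp add: vec_eq_iff matrix_matrix_mult_def sum_3 algebra_simps)

lemma matrix_inv_eqI:
  fixes A B :: "real^3^3"
  assumes "A ** B = mat 1" "B ** A = mat 1"
  shows "matrix_inv A = B"
proof -
  have inv: "A ** matrix_inv A = mat 1 \<and> matrix_inv A ** A = mat 1"
    unfolding matrix_inv_def by (rule someI[of _ B]) (rule conjI[OF assms])
  have "matrix_inv A = (matrix_inv A ** A) ** B"
    unfolding matrix_mul_assoc[symmetric] assms(1) by (simp only: matrix_mul_rid)
  also have "\<dots> = B" using inv by (simp only: matrix_mul_lid)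
  finally show ?thesis .
qed

lemma matrix_inv_geom:
  assumes "N \<ge> 1" "\<xi> \<in> ref_cube" "\<bar>\<alpha>\<bar> < 1/3"
  shows "matrix_inv (parent_D (geom N \<alpha> e) \<xi>)
    = (2 * real N) *\<^sub>R shear (- (1 / (1 + bump \<alpha> e \<xi> $ 1)) *\<^sub>R bump \<alpha> e \<xi>)"
proof (rule matrix_inv_eqI)
  have "1 + bump \<alpha> e \<xi> $ 1 \<noteq> 0" using bump_1_bound[OF assms(2), of \<alpha> e] assms(3) by linarith
  note s = shear_inverse[OF this]
  show "parent_D (geom N \<alpha> e) \<xi> ** (2 * real N) *\<^sub>R shear (- (1 / (1 + bump \<alpha> e \<xi> $ 1)) *\<^sub>R bump \<alpha> e \<xi>) = mat 1"
    "(2 * real N) *\<^sub>R shear (- (1 / (1 + bump \<alpha> e \<xi> $ 1)) *\<^sub>R bump \<alpha> e \<xi>) ** parent_D (geom N \<alpha> e) \<xi> = mat 1"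
    unfolding parent_D_geom[OF assms(2)] matrix_mult_scaleR s using assms(1) by simp_all
qed

section \<open>The inverse of the checkerboard map\<close>

text \<open>The triangular wave of period 4; in the scaled coordinate \<open>s = 2 N x$m\<close> it equals
  \<open>(-1) ^ (e$m) * \<xi>$m\<close>.\<close>

definition wave :: "real \<Rightarrow> real" where
  "wave s = (-1) ^ nat \<lfloor>s / 2\<rfloor> * (s - 1 - 2 * real (nat \<lfloor>s / 2\<rfloor>))"

text \<open>Reflecting every second cell makes the local coordinate a 1-Lipschitz triangular wave.
  Points in cells two or more apart have distance at least 2, while the values differ by at most
  2.\<close>

lemma signed_coordinate_lipschitz:
  fixes x y :: real
  assumes "\<bar>x\<bar> \<le> 1" "\<bar>y\<bar> \<le> 1"
  shows "\<bar>(-1) ^ i * x - (-1) ^ j * y\<bar> \<le> \<bar>(2 * real i + 1 + x) - (2 * real j + 1 + y)\<bar>"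
  using assms
proof (induction i j arbitrary: x y rule: linorder_wlog)
  case (le i j)
  consider "j = i" | "j = Suc i" | "real j \<ge> real i + 2" using le(1) by linarith
  then show ?case
  proof cases
    case 1
    then show ?thesis by (simp add: abs_mult power_abs flip: right_diff_distrib)
  next
    case 2
    \<comment> \<open>In adjacent cells the signs are opposite, and the claim |x + y| \<le> 2 + y -
      x amounts to x \<le> 1 and -1 \<le> y.\<close>
    then have "(-1) ^ i * x - (-1) ^ j * y = (-1) ^ i * (x + y)" by (simp add: algebra_simps)
    then have "\<bar>(-1) ^ i * x - (-1) ^ j * y\<bar> = \<bar>x + y\<bar>" by (simp add: abs_mult power_abs)
    then show ?thesis using 2 le(2,3) by simp
  next
    case 3
    have "\<bar>(-1) ^ i * x - (-1) ^ j * y\<bar> \<le> \<bar>(-1) ^ i * x\<bar> + \<bar>(-1) ^ j * y\<bar>" by (rule abs_triangle_ineq4)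
    also have "\<dots> \<le> 2" using le(2,3) by (simp add: abs_mult power_abs)
    finally show ?thesis using 3 le(2,3) by linarith
  qed
next
  case (sym i j)
  show ?case using sym(1)[OF sym(3,2)] by (simp add: abs_minus_commute)
qed

lemma wave_decompose:
  assumes "s \<ge> 0"
  obtains k x where "s = 2 * real k + 1 + x" "\<bar>x\<bar> \<le> 1" "wave s = (-1) ^ k * x"
proof -
  let ?k = "nat \<lfloor>s / 2\<rfloor>"
  have "real ?k = of_int \<lfloor>s / 2\<rfloor>" using assms by simp
  moreover have "of_int \<lfloor>s / 2\<rfloor> \<le> s / 2" "s / 2 < of_int \<lfloor>s / 2\<rfloor> + 1" by linarith+
  ultimately have "\<bar>s - 1 - 2 * real ?k\<bar> \<le> 1" unfolding abs_le_iff by linarith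
  moreover have "s = 2 * real ?k + 1 + (s - 1 - 2 * real ?k)" by simp
  ultimately show thesis using wave_def by (intro that)
qed

lemma wave_lipschitz: "s \<ge> 0 \<Longrightarrow> t \<ge> 0 \<Longrightarrow> \<bar>wave s - wave t\<bar> \<le> \<bar>s - t\<bar>"
  by (metis wave_decompose signed_coordinate_lipschitz)

lemma wave_abs_le: "s \<ge> 0 \<Longrightarrow> \<bar>wave s\<bar> \<le> 1"
  by (rule wave_decompose[of s]) (auto simp: abs_mult power_abs)

text \<open>A point on a face has two decompositions; the Lipschitz bound at distance 0 shows that
  they give the same value.\<close>

lemma wave_cell:
  assumes "\<bar>x\<bar> \<le> 1"
  shows "wave (2 * real k + 1 + x) = (-1) ^ k * x"
proof -
  have "2 * real k + 1 + x \<ge> 0" using assms by linarith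
  then obtain j y where "2 * real k + 1 + x = 2 * real j + 1 + y" "\<bar>y\<bar> \<le> 1"
    "wave (2 * real k + 1 + x) = (-1) ^ j * y"
    by (rule wave_decompose)
  then show ?thesis using signed_coordinate_lipschitz[OF assms, of y k j] by simp
qed

lemma unit_cube_iff:
  fixes x :: "real^3"
  shows "x \<in> cbox 0 (vec 1) \<longleftrightarrow> (\<forall>m. 0 \<le> x$m \<and> x$m \<le> 1)"
    "x \<in> cbox 0 1 \<longleftrightarrow> (\<forall>m. 0 \<le> x$m \<and> x$m \<le> 1)"
  by (simp_all add: mem_box_cart)

lemma cell_map_in_unit_cube:
  assumes "N \<ge> 1" "e \<in> cells N" "\<xi> \<in> ref_cube"
  shows "cell_map N e \<xi> \<in> cbox 0 (vec 1)"
proof -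
  have "0 \<le> 2 * real (e$m) + 1 + \<xi>$m \<and> 2 * real (e$m) + 1 + \<xi>$m \<le> 2 * real N" for m
  proof -
    have "e$m < N" using assms(2) by (simp add: cells_def)
    then have "real (e$m) + 1 \<le> real N" by linarith
    then show ?thesis using ref_cube_abs[OF assms(3), of m] by linarith
  qed
  then show ?thesis
    using assms(1) by (simp add: unit_cube_iff cell_map_def field_simps)
qed

lemma unit_interval_cell:
  assumes "N \<ge> 1" "0 \<le> t" "t \<le> 1"
  obtains i x where "i < N" "\<bar>x\<bar> \<le> 1" "2 * real N * t = 2 * real i + 1 + x"
proof (cases "t = 1")
  case True
  \<comment> \<open>The floor would give the index \<open>N\<close> at the right end point, so that
    point goes to the last cell.\<close>
  then show thesis using assms(1) by (intro that[of "N - 1" 1]) (auto simp: of_nat_diff)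
next
  case False
  let ?i = "nat \<lfloor>real N * t\<rfloor>"
  have nn: "0 \<le> real N * t" using assms by simp
  then have i: "real ?i = of_int \<lfloor>real N * t\<rfloor>" by simp
  have "real N * t < real N" using False assms by simp
  then have "?i < N" using i by linarith
  moreover have "\<bar>2 * real N * t - 2 * real ?i - 1\<bar> \<le> 1"
  proof -
    have "of_int \<lfloor>real N * t\<rfloor> \<le> real N * t" "real N * t < of_int \<lfloor>real N * t\<rfloor> + 1" by linarith+
    then show ?thesis using i unfolding abs_le_iff mult.assoc by linarith
  qed
  moreover have "2 * real N * t = 2 * real ?i + 1 + (2 * real N * t - 2 * real ?i - 1)" by simp
  ultimately show thesis by (rule that)
qed

lemma unit_cube_cell:
  assumes "N \<ge> 1" "x \<in> cbox 0 (vec 1)"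
  obtains e \<xi> where "e \<in> cells N" "\<xi> \<in> ref_cube" "x = cell_map N e \<xi>"
proof -
  have "\<exists>i y. i < N \<and> \<bar>y\<bar> \<le> 1 \<and> 2 * real N * x$m = 2 * real i + 1 + y" for m
    using unit_interval_cell[OF assms(1), of "x$m"] assms(2) unfolding unit_cube_iff(1) by metis
  then obtain i y where iy: "\<And>m. i m < N" "\<And>m. \<bar>y m\<bar> \<le> 1"
    "\<And>m. 2 * real N * x$m = 2 * real (i m) + 1 + y m" by metis
  show thesis
  proof
    show "(\<chi> m. i m) \<in> cells N" using iy(1) by (simp add: cells_def)
    show "(\<chi> m. y m) \<in> ref_cube" using iy(2) by (simp add: ref_cube_def mem_box_cart abs_le_iff minus_le_iff)
    show "x = cell_map N (\<chi> m. i m) (\<chi> m. y m)"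
      using iy(3) assms(1) by (simp add: vec_eq_iff cell_map_def flip: iy(3))
  qed
qed

section \<open>The global map in closed form\<close>

definition wave_bump :: "nat \<Rightarrow> real^3 \<Rightarrow> real" where
  "wave_bump N x = wave (2 * real N * x$1) ^ 3 * wave (2 * real N * x$2) * wave (2 * real N * x$3)"

text \<open>The checkerboard sign is absorbed into the three waves, which leaves one formula for all
  cells; continuity and injectivity are read off from it.\<close>

lemma global_map_wave:
  assumes "N \<ge> 1" "x \<in> cbox 0 (vec 1)"
  shows "global_map N \<alpha> x = x + (1 / real N * \<alpha> / 2 * wave_bump N x) *\<^sub>R axis 1 1"
proof -
  obtain e \<xi> where e: "e \<in> cells N" "\<xi> \<in> ref_cube" "x = cell_map N e \<xi>"
    using unit_cube_cell[OF assms] .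
  have "2 * real N * x$m = 2 * real (e$m) + 1 + \<xi>$m" for m
    using assms(1) by (simp add: e(3) cell_map_def)
  then have w: "wave (2 * real N * x$m) = (-1) ^ (e$m) * \<xi>$m" for m
    by (simp only: wave_cell[OF ref_cube_abs[OF e(2)]])
  \<comment> \<open>The power 3 is odd, so the first wave keeps its sign when cubed.\<close>
  have "((-1) ^ k) ^ 3 = ((-1) ^ k :: real)" for k :: nat
    by (cases "even k") auto
  then have "wave_bump N x = cell_sign e * ((\<xi>$1)^3 * \<xi>$2 * \<xi>$3)"
    by (simp only: wave_bump_def w power_mult_distrib cell_sign_def power_add) simp
  moreover have "global_map N \<alpha> x = geom N \<alpha> e \<xi>"
    using global_map_cell[of N e \<xi>] assms(1) e by simp
  ultimately show ?thesis using e(3) by (simp add: geom_def mult.assoc)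
qed

lemma continuous_on_wave: "continuous_on {0..} wave"
proof -
  have "1-lipschitz_on {0..} wave"
    by (rule lipschitz_onI) (auto simp: dist_real_def wave_lipschitz)
  then show ?thesis by (rule lipschitz_on_continuous_on)
qed

lemma continuous_on_global_map:
  assumes "N \<ge> 1"
  shows "continuous_on (cbox 0 (vec 1)) (global_map N \<alpha>)"
proof -
  have "continuous_on (cbox 0 (vec 1)) (\<lambda>x::real^3. wave (2 * real N * x$m))" for m
    by (rule continuous_on_compose2[OF continuous_on_wave])
      (auto intro!: continuous_intros simp: unit_cube_iff)
  then have "continuous_on (cbox 0 (vec 1)) (\<lambda>x. x + (1 / real N * \<alpha> / 2 * wave_bump N x) *\<^sub>R axis 1 1)"
    unfolding wave_bump_def by (intro continuous_intros)
  then show ?thesis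
    by (rule continuous_on_eq) (simp add: global_map_wave[OF assms])
qed

lemma cube_diff_le: "\<bar>a\<bar> \<le> 1 \<Longrightarrow> \<bar>b\<bar> \<le> 1 \<Longrightarrow> \<bar>a^3 - b^3\<bar> \<le> 3 * \<bar>a - b\<bar>" for a b :: real
proof -
  assume ab: "\<bar>a\<bar> \<le> 1" "\<bar>b\<bar> \<le> 1"
  have "\<bar>a^2 + a*b + b^2\<bar> \<le> \<bar>a\<bar>^2 + \<bar>a\<bar>*\<bar>b\<bar> + \<bar>b\<bar>^2"
    using abs_triangle_ineq[of "a^2 + a*b" "b^2"] abs_triangle_ineq[of "a^2" "a*b"]
    by (simp add: abs_mult)
  also have "\<dots> \<le> 1 + 1 * 1 + 1"
    using ab by (intro add_mono mult_mono power_le_one) auto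
  finally have "\<bar>a - b\<bar> * \<bar>a^2 + a*b + b^2\<bar> \<le> \<bar>a - b\<bar> * 3"
    by (intro mult_left_mono) auto
  moreover have "a^3 - b^3 = (a - b) * (a^2 + a*b + b^2)"
    by (simp add: algebra_simps power2_eq_square power3_eq_cube)
  ultimately show ?thesis by (simp add: abs_mult)
qed

text \<open>Only the first coordinate is displaced, and its displacement is Lipschitz there with
  constant (h |\<alpha>| / 2) * 3 * 2N = 3 |\<alpha>| < 1, so it cannot undo a difference of the
  points.\<close>

lemma inj_on_global_map:
  assumes N: "N \<ge> 1" and \<alpha>: "\<bar>\<alpha>\<bar> < 1/3"
  shows "inj_on (global_map N \<alpha>) (cbox 0 (vec 1))"
proof (rule inj_onI)
  fix x y :: "real^3"
  assume x: "x \<in> cbox 0 (vec 1)" and y: "y \<in> cbox 0 (vec 1)" and eq: "global_map N \<alpha> x = global_map N \<alpha> y"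
  let ?w = "\<lambda>x m. wave (2 * real N * x$m)"
  let ?k = "1 / real N * \<alpha> / 2"
  note eq' = eq[unfolded global_map_wave[OF N x] global_map_wave[OF N y], unfolded vec_eq_iff forall_3]
  have c: "x$2 = y$2" "x$3 = y$3" and c1: "x$1 + ?k * wave_bump N x = y$1 + ?k * wave_bump N y"
    using eq' by (simp_all add: axis_def)
  have nn: "0 \<le> 2 * real N * x$m" "0 \<le> 2 * real N * y$m" for m
    using x y by (auto simp: unit_cube_iff)
  have "\<bar>wave_bump N x - wave_bump N y\<bar> = \<bar>?w x 1 ^ 3 - ?w y 1 ^ 3\<bar> * \<bar>?w y 2 * ?w y 3\<bar>"
    by (simp add: wave_bump_def c algebra_simps flip: abs_mult)
  also have "\<dots> \<le> (3 * (2 * real N * \<bar>x$1 - y$1\<bar>)) * 1"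
  proof (rule mult_mono)
    have "\<bar>?w x 1 ^ 3 - ?w y 1 ^ 3\<bar> \<le> 3 * \<bar>?w x 1 - ?w y 1\<bar>"
      by (intro cube_diff_le wave_abs_le nn)
    also have "\<dots> \<le> 3 * \<bar>2 * real N * x$1 - 2 * real N * y$1\<bar>"
      using wave_lipschitz[OF nn(1) nn(2), of 1 1] by simp
    also have "\<bar>2 * real N * x$1 - 2 * real N * y$1\<bar> = 2 * real N * \<bar>x$1 - y$1\<bar>"
      by (simp add: abs_mult flip: right_diff_distrib)
    finally show "\<bar>?w x 1 ^ 3 - ?w y 1 ^ 3\<bar> \<le> 3 * (2 * real N * \<bar>x$1 - y$1\<bar>)" .
    show "\<bar>?w y 2 * ?w y 3\<bar> \<le> 1"
      using wave_abs_le[OF nn(2), of 2] wave_abs_le[OF nn(2), of 3]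
      by (simp add: abs_mult mult_le_one)
  qed auto
  finally have "\<bar>?k\<bar> * \<bar>wave_bump N x - wave_bump N y\<bar> \<le> \<bar>?k\<bar> * (3 * (2 * real N * \<bar>x$1 - y$1\<bar>))"
    by (intro mult_left_mono) auto
  also have "\<dots> = 3 * \<bar>\<alpha>\<bar> * \<bar>x$1 - y$1\<bar>"
    using N by (simp add: abs_mult)
  finally have "\<bar>?k * wave_bump N y - ?k * wave_bump N x\<bar> \<le> 3 * \<bar>\<alpha>\<bar> * \<bar>x$1 - y$1\<bar>"
    by (simp only: abs_minus_commute abs_mult flip: right_diff_distrib)
  moreover have "x$1 - y$1 = ?k * wave_bump N y - ?k * wave_bump N x" using c1 by linarith
  ultimately have "\<bar>x$1 - y$1\<bar> \<le> 3 * \<bar>\<alpha>\<bar> * \<bar>x$1 - y$1\<bar>" by simp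
  moreover have "3 * \<bar>\<alpha>\<bar> * \<bar>x$1 - y$1\<bar> < 1 * \<bar>x$1 - y$1\<bar>" if "x$1 \<noteq> y$1"
    using \<alpha> that by (intro mult_strict_right_mono) auto
  ultimately have "x$1 = y$1" by fastforce
  then show "x = y" using c by (simp add: vec_eq_iff forall_3)
qed

text \<open>The field k X_h^-1; the closure of the domain lies in the image of the closed cube,
  where the inverse is determined.\<close>

definition inverse_field :: "nat \<Rightarrow> real \<Rightarrow> real \<Rightarrow> real^3 \<Rightarrow> real^3" where
  "inverse_field N \<alpha> k y = k *\<^sub>R the_inv_into (cbox 0 (vec 1)) (global_map N \<alpha>) y"

lemma inverse_field_geom:
  assumes "N \<ge> 1" "\<bar>\<alpha>\<bar> < 1/3" "e \<in> cells N" "\<xi> \<in> ref_cube"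
  shows "inverse_field N \<alpha> k (geom N \<alpha> e \<xi>) = k *\<^sub>R cell_map N e \<xi>"
  using the_inv_into_f_f[OF inj_on_global_map[OF assms(1,2)] cell_map_in_unit_cube[OF assms(1,3,4)]]
    global_map_cell[of N e \<xi> \<alpha>] assms by (simp add: inverse_field_def)

text \<open>In parent coordinates the field is the affine cell map, so all degrees stay within
  exactness. It is continuous as the inverse of a continuous injection on a compact set.\<close>

lemma inverse_field_in_Z_Q:
  assumes N: "N \<ge> 1" and \<alpha>: "\<bar>\<alpha>\<bar> < 1/3"
  shows "inverse_field N \<alpha> k \<in> Z_Q N \<alpha>"
  unfolding exact_class_def candidates_def
proof (intro CollectI conjI ballI)
  let ?C = "cbox 0 (vec 1) :: (real^3) set"
  have "closed (global_map N \<alpha> ` ?C)"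
    by (intro compact_imp_closed compact_continuous_image continuous_on_global_map N compact_cbox)
  then have "closure (domain_h N \<alpha>) \<subseteq> global_map N \<alpha> ` ?C"
    unfolding domain_h_def by (intro closure_minimal image_mono box_subset_cbox)
  moreover have "continuous_on (global_map N \<alpha> ` ?C) (inverse_field N \<alpha> k)"
    unfolding inverse_field_def[abs_def]
    by (intro continuous_on_scaleR continuous_on_const continuous_on_inv_into continuous_on_global_map
      inj_on_global_map N \<alpha> compact_cbox)
  ultimately show "continuous_on (closure (domain_h N \<alpha>)) (inverse_field N \<alpha> k)"
    by (rule continuous_on_subset[rotated])
next
  fix e assume e: "e \<in> cells N"
  have w: "inverse_field N \<alpha> k (geom N \<alpha> e \<eta>) = k *\<^sub>R geom N 0 e \<eta>" if "\<eta> \<in> ref_cube" for \<eta>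
    using inverse_field_geom[OF N \<alpha> e that] by (simp add: cell_map_eq_geom)
  show "\<exists>p\<in>vector_span S3_exps. \<forall>\<xi>\<in>ref_cube. inverse_field N \<alpha> k (geom N \<alpha> e \<xi>) = p \<xi>"
    by (rule bexI[of _ "\<lambda>\<eta>. k *\<^sub>R geom N 0 e \<eta>"]) (simp_all add: scaled_geom_span w)
  show "quad_defect (\<lambda>\<xi>. inverse_field N \<alpha> k (geom N \<alpha> e \<xi>)) u v = 0"
    if "u \<in> vector_span Q3_exps" "v \<in> vector_span Q3_exps" for u v
    by (rule quad_defect_geom[where \<alpha> = 0, OF w subset_refl that]) simp_all
qed

section \<open>Margins of the two explicit potentials\<close>

lemma R_field_identity:
  assumes "N \<ge> 1" "\<xi> \<in> ref_cube" "\<bar>\<alpha>\<bar> < 1/3"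
  shows "R_field N \<alpha> (\<lambda>x. k *\<^sub>R x) e \<xi> = k *\<^sub>R mat 1"
proof -
  have "1 + bump \<alpha> e \<xi> $ 1 \<noteq> 0" using bump_1_bound[OF assms(2), of \<alpha> e] assms(3) by linarith
  note s = shear_inverse[OF this]
  show ?thesis
    unfolding R_field_def matrix_inv_geom[OF assms] parent_D_scaled_geom[OF refl assms(2)]
      matrix_mult_scaleR s
    using assms(1) by simp
qed

lemma margin_identity:
  assumes "N \<ge> 1" "material N c c1 c2" "\<bar>\<alpha>\<bar> < 1/3"
  shows "margin N \<alpha> c1 c2 (\<lambda>x. (2 * c) *\<^sub>R x) = c"
proof (rule antisym)
  show "c \<le> margin N \<alpha> c1 c2 (\<lambda>x. (2 * c) *\<^sub>R x)"
  proof (rule margin_ge[OF assms(1)])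
    fix e \<xi> and H :: "real^3^3" assume e: "e \<in> cells N" "\<xi> \<in> gauss_points 4" "H \<noteq> 0"
    show "c \<le> margin_ratio (c1 e) (c2 e) (R_field N \<alpha> (\<lambda>x. (2 * c) *\<^sub>R x) e \<xi>) H"
      using hess_iso_add_cof[of "c1 e" "c2 e" H] A_form_pos[OF e(3)]
      by (simp add: R_field_identity[OF assms(1) gauss_points4_ref_cube[OF e(2)] assms(3)]
          margin_ratio_def mdot_inner material_sum[OF assms(2) e(1)])
  qed
qed (rule margin_le_c[OF assms(1,2)])

lemma R_field_inverse:
  assumes "N \<ge> 1" "e \<in> cells N" "\<xi> \<in> ref_cube" "\<bar>\<alpha>\<bar> < 1/3"
  shows "R_field N \<alpha> (inverse_field N \<alpha> k) e \<xi>
    = k *\<^sub>R shear (- (1 / (1 + bump \<alpha> e \<xi> $ 1)) *\<^sub>R bump \<alpha> e \<xi>)"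
proof -
  have "parent_D (\<lambda>\<eta>. inverse_field N \<alpha> k (geom N \<alpha> e \<eta>)) \<xi> = (k / real N / 2) *\<^sub>R shear (bump 0 e \<xi>)"
    by (rule parent_D_scaled_geom[OF _ assms(3)])
      (simp add: inverse_field_geom[OF assms(1,4,2)] cell_map_eq_geom)
  moreover have "shear (bump 0 e \<xi>) = mat 1"
    by (simp add: vec_eq_iff shear_nth bump_def mat_def)
  ultimately show ?thesis
    unfolding R_field_def matrix_inv_geom[OF assms(1,3,4)] using assms(1)
    by (simp only: matrix_mult_scaleR matrix_mul_lid) simp
qed

text \<open>The first cofactor row is the cross product of the other two rows of
  \<open>H\<close>.\<close>

lemma norm_cof_row: "norm (cof H $ 1) \<le> H \<bullet> H"
proof -
  have "cof H $ 1 = cross3 (H$2) (H$3)"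
    by (simp add: cof_def cross3_def vec_eq_iff forall_3)
  moreover have "(norm (cross3 (H$2) (H$3)))^2 \<le> (norm (H$2) * norm (H$3))^2"
    using norm_cross_dot[of "H$2" "H$3"] zero_le_power2[of "H$2 \<bullet> H$3"] by linarith
  ultimately have "norm (cof H $ 1) \<le> norm (H$2) * norm (H$3)"
    by (simp add: abs_le_square_iff)
  also have "\<dots> \<le> (norm (H$2))^2 + (norm (H$3))^2"
    using sum_squares_bound[of "norm (H$2)" "norm (H$3)"] mult_nonneg_nonneg[OF norm_ge_zero norm_ge_zero, of "H$2" "H$3"]
    by linarith
  also have "\<dots> \<le> H \<bullet> H"
    by (simp add: power2_norm_eq_inner inner_vec_def[of H] sum_3)
  finally show ?thesis .
qed

text \<open>With v the bump and d = 1 / (1 + v_1), R_z is 2 c (I - d e_1 v^T). The identity part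
  contributes exactly \<open>c\<close>; the rank-one part costs at most 2 c \<delta> / (1 -
  \<delta>), and c minus this is the stated bound.\<close>

lemma margin_inverse_field:
  assumes N: "N \<ge> 1" and mat: "material N c c1 c2" and \<alpha>: "\<bar>\<alpha>\<bar> < 1 / (3 * sqrt 11)"
  shows "c * ((1 - 3 * (sqrt 11 * \<bar>\<alpha>\<bar>)) / (1 - sqrt 11 * \<bar>\<alpha>\<bar>)) \<le> margin N \<alpha> c1 c2 (inverse_field N \<alpha> (2 * c))"
proof (rule margin_ge[OF N])
  fix e \<xi> and H :: "real^3^3" assume e: "e \<in> cells N" "\<xi> \<in> gauss_points 4" "H \<noteq> 0"
  note \<xi> = gauss_points4_ref_cube[OF e(2)]
  have c: "c > 0" using mat by (simp add: material_def)
  let ?\<delta> = "sqrt 11 * \<bar>\<alpha>\<bar>"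
  let ?v = "bump \<alpha> e \<xi>"
  let ?d = "1 / (1 + ?v $ 1)"
  have s11: "3 \<le> sqrt 11" by (simp add: real_le_rsqrt)
  have \<delta>: "3 * ?\<delta> < 1" using \<alpha> by (simp add: field_simps)
  have \<delta>3: "3 * \<bar>\<alpha>\<bar> \<le> ?\<delta>" using s11 by (intro mult_right_mono) auto
  then have \<alpha>3: "\<bar>\<alpha>\<bar> < 1/3" using \<delta> by linarith
  have v1: "1 - ?\<delta> \<le> 1 + ?v $ 1" using bump_1_bound[OF \<xi>, of \<alpha> e] \<delta>3 by linarith
  have d: "0 < ?d" "?d \<le> 1 / (1 - ?\<delta>)" using v1 \<delta> by (auto simp: frac_le)
  \<comment> \<open>Only the first cofactor row meets the rank-one part; the 4 is 2 from the factor
    \<open>2 * c\<close> times 2 from \<open>mcross_self\<close>.\<close>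
  have R: "R_field N \<alpha> (inverse_field N \<alpha> (2 * c)) e \<xi> \<bullet> (H \<times>\<^sub>M H)
      = (2 * c) *\<^sub>R mat 1 \<bullet> (H \<times>\<^sub>M H) - 4 * c * ?d * (?v \<bullet> cof H $ 1)"
    unfolding R_field_inverse[OF N e(1) \<xi> \<alpha>3] mcross_self
    by (simp add: inner_vec_def sum_3 shear_nth mat_def algebra_simps)
  have "\<bar>?v \<bullet> cof H $ 1\<bar> \<le> ?\<delta> * (H \<bullet> H)"
    by (rule order_trans[OF Cauchy_Schwarz_ineq2]) (intro mult_mono norm_bump \<xi> norm_cof_row; simp)
  also have "\<dots> \<le> ?\<delta> * (A_form H H / 2)"
    using A_form_ge[of H] by (intro mult_left_mono) auto
  finally have "?d * \<bar>?v \<bullet> cof H $ 1\<bar> \<le> 1 / (1 - ?\<delta>) * (?\<delta> * (A_form H H / 2))"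
    using d order_trans[OF less_imp_le[OF d(1)] d(2)] by (intro mult_mono) auto
  then have "4 * c * (?d * \<bar>?v \<bullet> cof H $ 1\<bar>) \<le> 4 * c * (1 / (1 - ?\<delta>) * (?\<delta> * (A_form H H / 2)))"
    using c by (intro mult_left_mono) auto
  moreover have "4 * c * ?d * (?v \<bullet> cof H $ 1) \<le> 4 * c * (?d * \<bar>?v \<bullet> cof H $ 1\<bar>)"
    unfolding mult.assoc using c d(1) by (intro mult_left_mono) auto
  moreover have "4 * c * (1 / (1 - ?\<delta>) * (?\<delta> * (A_form H H / 2))) = 2 * c * (?\<delta> / (1 - ?\<delta>)) * A_form H H"
  proof -
    have "?\<delta> / (1 - ?\<delta>) = ?\<delta> * (1 / (1 - ?\<delta>))" by simp
    moreover have "4 * c * (k * (?\<delta> * (A_form H H / 2))) = 2 * c * (?\<delta> * k) * A_form H H" for k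
      by (simp add: algebra_simps)
    ultimately show ?thesis by (simp only:)
  qed
  ultimately have "(c - 2 * c * (?\<delta> / (1 - ?\<delta>))) * A_form H H
      \<le> hess_iso (c1 e) (c2 e) H H + R_field N \<alpha> (inverse_field N \<alpha> (2 * c)) e \<xi> :\<cdot> (H \<times>\<^sub>M H)"
    using hess_iso_add_cof[of "c1 e" "c2 e" H] R
    unfolding mdot_inner material_sum[OF mat e(1)] left_diff_distrib by linarith
  moreover have "c * ((1 - 3 * ?\<delta>) / (1 - ?\<delta>)) = c - 2 * c * (?\<delta> / (1 - ?\<delta>))"
    using \<delta> by (simp add: field_simps)
  ultimately show "c * ((1 - 3 * ?\<delta>) / (1 - ?\<delta>)) \<le> margin_ratio (c1 e) (c2 e) (R_field N \<alpha> (inverse_field N \<alpha> (2 * c)) e \<xi>) H"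
    using A_form_pos[OF e(3)] by (simp add: margin_ratio_def pos_le_divide_eq)
qed

section \<open>The upper bound for the full tensor class\<close>

text \<open>Exponents of the test pair. The superlinear degree of \<open>m320\<close> is 5, so it
  belongs to \<open>Q3_exps\<close> but not to \<open>S3_exps\<close>.\<close>

definition m300 :: "nat^3" where "m300 = vector [3, 0, 0]"
definition m320 :: "nat^3" where "m320 = vector [3, 2, 0]"

lemma m300_m320_nth [simp]:
  "m300 $ 1 = 3" "m300 $ 2 = 0" "m300 $ 3 = 0" "m320 $ 1 = 3" "m320 $ 2 = 2" "m320 $ 3 = 0"
  by (simp_all add: m300_def m320_def)

text \<open>The determinant of the exponent vectors is 6 times \<open>m$3\<close>. Parity forces
  \<open>m$2\<close> and \<open>m$3\<close> to be odd, and an inexact first exponent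
  \<open>m$1 + 5\<close> forces \<open>m$1 = 3\<close>; within \<open>S3_exps\<close> only
  \<open>m311\<close> is left.\<close>

lemma triple_error_m300_m320:
  assumes m: "m \<in> S3_exps"
  shows "triple_error m m300 m320 \<noteq> 0 \<longleftrightarrow> m = m311"
proof -
  let ?k = "\<chi> i. m$i + m300$i + m320$i - 1 :: nat^3"
  have k: "?k$1 = m$1 + 5" "?k$2 = m$2 + 1" "?k$3 = m$3 - 1" by simp_all
  have le3: "m$i \<le> 3" for i using m S3_exps_subset_Q3_exps by (auto simp: Q3_exps_def)
  have t: "triple_error m m300 m320 = 6 * real (m$3) * quad_error (monomial ?k)"
    unfolding triple_error_eq by (simp add: triple_eq real_vec_def)
  show ?thesis
  proof
    assume "triple_error m m300 m320 \<noteq> 0"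
    then have m3: "m$3 \<noteq> 0" and q: "quad_error (monomial ?k) \<noteq> 0" by (auto simp: t)
    have "even (?k$2)" "even (?k$3)" using q quad_error_monomial_odd by blast+
    \<comment> \<open>\<open>m$3\<close> is nonzero here, so \<open>m$3 - 1\<close> is not truncated
      and has the opposite parity.\<close>
    then have odd: "odd (m$2)" "odd (m$3)" unfolding k using m3 by auto
    have "m$1 \<ge> 3"
    proof (rule ccontr)
      assume "\<not> m$1 \<ge> 3"
      then have "\<forall>i. ?k$i \<le> 7 \<or> odd (?k$i)"
        unfolding forall_3 k using le3[of 2] le3[of 3] by linarith
      then show False using q quad_error_monomial_exact by blast
    qed
    then have "m$1 = 3" using le3[of 1] by linarith
    moreover have "m$2 = 1" "m$3 = 1"
      using m odd \<open>m$1 = 3\<close> by (auto simp: S3_exps_iff split: if_splits) presburger+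
    ultimately show "m = m311" by (simp add: vec_eq_iff forall_3)
  next
    assume m: "m = m311"
    \<comment> \<open>The product monomial has exponents 8, 2, 0; in the last two coordinates the
      rule is exact, with moments 2/3 and 2.\<close>
    have "quad_error (monomial ?k) = (gauss_moment 8 - moment 8) * (2/3 * 2)"
      unfolding m by (simp add: quad_error_monomial prod_UNIV_3 gauss_moment_low
        gauss_moment_low(2)[unfolded numeral_2_eq_2] moment_eq algebra_simps)
    then have "quad_error (monomial ?k) \<noteq> 0" using gauss_moment_8 by simp
    then show "triple_error m m300 m320 \<noteq> 0" unfolding t by (simp add: m)
  qed
qed

definition single_field :: "3 \<Rightarrow> nat^3 \<Rightarrow> real^3 \<Rightarrow> real^3" where
  "single_field j n x = (\<chi> i. if i = j then monomial n x else 0)"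

lemma single_field_span:
  assumes "n \<in> M" "finite M"
  shows "single_field j n \<in> vector_span M"
proof -
  have "single_field j n x $ i = (\<Sum>m\<in>M. (if m = n then (if i = j then 1 else 0) else 0) * monomial m x)" for i x
    using assms by (simp add: single_field_def if_distrib[of "\<lambda>a. a * _"] cong: if_cong)
  then show ?thesis
    unfolding vector_span_def monomial_span_def by (intro CollectI allI exI)
qed

text \<open>One admissible test pair reads off the coefficient: all other monomials of the field
  have zero error against it.\<close>

lemma Z_Q_top_coefficient:
  assumes z: "z \<in> Z_Q N \<alpha>" and e: "e \<in> cells N"
  obtains a where "\<And>\<eta> i. \<eta> \<in> ref_cube \<Longrightarrow> z (geom N \<alpha> e \<eta>) $ i = (\<Sum>m\<in>S3_exps. a i m * monomial m \<eta>)"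
    "a 1 m311 = 0"
proof -
  obtain p where p: "p \<in> vector_span S3_exps" "\<forall>\<xi>\<in>ref_cube. z (geom N \<alpha> e \<xi>) = p \<xi>"
    using z e by (auto simp: exact_class_def candidates_def)
  obtain a where a: "\<forall>x i. p x $ i = (\<Sum>m\<in>S3_exps. a i m * monomial m x)"
    using vector_spanD[OF p(1)] by blast
  then have za: "z (geom N \<alpha> e \<eta>) $ i = (\<Sum>m\<in>S3_exps. a i m * monomial m \<eta>)" if "\<eta> \<in> ref_cube" for \<eta> i
    using p(2) that by simp
  have Q: "m300 \<in> Q3_exps" "m320 \<in> Q3_exps" by (auto simp: Q3_exps_def forall_3)
  have f: "single_field j n \<eta> $ i = (\<Sum>m\<in>{n}. (if i = j then 1 else 0) * monomial m \<eta>)" for i j n \<eta>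
    by (simp add: single_field_def)
  \<comment> \<open>Test fields in components 2 and 3 pair only with component 1 of the
    potential.\<close>
  have "0 = quad_defect (\<lambda>\<eta>. z (geom N \<alpha> e \<eta>)) (single_field 2 m300) (single_field 3 m320)"
    using z e single_field_span[OF Q(1) finite_Q3_exps] single_field_span[OF Q(2) finite_Q3_exps]
    by (simp add: exact_class_def)
  also have "\<dots> = (\<Sum>(m, n, l)\<in>S3_exps \<times> {m300} \<times> {m320}. a 1 m * triple_error m n l)"
    by (subst quad_defect_polynomial[OF finite_S3_exps _ _ za f f]) simp_all
  also have "\<dots> = (\<Sum>m\<in>S3_exps. a 1 m * triple_error m m300 m320)"
    by (simp flip: sum.cartesian_product)
  also have "\<dots> = (\<Sum>m\<in>S3_exps. if m = m311 then a 1 m * triple_error m m300 m320 else 0)"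
    using triple_error_m300_m320 by (intro sum.cong refl) auto
  also have "\<dots> = a 1 m311 * triple_error m311 m300 m320"
    by (simp add: finite_S3_exps S3_exps_members)
  finally have "a 1 m311 = 0" using triple_error_m300_m320[of m311] S3_exps_members(3) by auto
  then show thesis using that za by blast
qed

section \<open>A signed sum over 16 Gauss points\<close>

definition mixed_difference :: "(real^3 \<Rightarrow> real) \<Rightarrow> real \<Rightarrow> real" where
  "mixed_difference f r = f (vector [r, gl_out, gl_out]) - f (vector [r, gl_out, - gl_out])
     - f (vector [r, - gl_out, gl_out]) + f (vector [r, - gl_out, - gl_out])"

text \<open>The mixed difference isolates exponents that are odd in the last two coordinates; of the remaining
  first partial derivatives only that of \<open>m311\<close> has a non-constant even part in the first coordinate.\<close>

definition node_functional :: "(real^3 \<Rightarrow> real) \<Rightarrow> real" where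
  "node_functional f = mixed_difference f gl_out + mixed_difference f (- gl_out)
     - mixed_difference f gl_in - mixed_difference f (- gl_in)"

lemma node_points:
  assumes "\<bar>r\<bar> = gl_out \<or> \<bar>r\<bar> = gl_in" "\<bar>s\<bar> = gl_out" "\<bar>t\<bar> = gl_out"
  shows "vector [r, s, t] \<in> gauss_points 4"
  using assms by (auto simp: gauss_points_def gauss_nodes4 forall_3 abs_eq_iff' abs_if split: if_splits)

lemma node_functional_bound:
  assumes "\<And>\<xi>. \<xi> \<in> gauss_points 4 \<Longrightarrow> \<bar>f \<xi>\<bar> \<le> B"
  shows "\<bar>node_functional f\<bar> \<le> 16 * B"
proof -
  have *: "\<bar>f (vector [r, s, t])\<bar> \<le> B" if "\<bar>r\<bar> = gl_out \<or> \<bar>r\<bar> = gl_in" "\<bar>s\<bar> = gl_out" "\<bar>t\<bar> = gl_out" for r s t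
    using assms node_points[OF that] by blast
  have g: "\<bar>gl_out\<bar> = gl_out" "\<bar>- gl_out\<bar> = gl_out" using gl_pos by simp_all
  have "\<bar>mixed_difference f r\<bar> \<le> 4 * B" if r: "\<bar>r\<bar> = gl_out \<or> \<bar>r\<bar> = gl_in" for r
    using *[OF r g(1) g(1)] *[OF r g(1) g(2)] *[OF r g(2) g(1)] *[OF r g(2) g(2)]
    unfolding mixed_difference_def by linarith
  note m = this
  have "\<bar>mixed_difference f gl_out\<bar> \<le> 4 * B" "\<bar>mixed_difference f (- gl_out)\<bar> \<le> 4 * B"
    "\<bar>mixed_difference f gl_in\<bar> \<le> 4 * B" "\<bar>mixed_difference f (- gl_in)\<bar> \<le> 4 * B"
    by (rule m; use gl_pos in simp)+
  then show ?thesis unfolding node_functional_def by linarith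
qed

lemma node_functional_sum:
  "node_functional (\<lambda>x. \<Sum>m\<in>M. a m * f m x) = (\<Sum>m\<in>M. a m * node_functional (f m))"
  by (simp add: node_functional_def mixed_difference_def sum_distrib_left sum_subtractf sum.distrib algebra_simps)

lemma node_functional_affine:
  "node_functional (\<lambda>\<xi>. f \<xi> - a * (b * (1 + g \<xi>))) = node_functional f - a * b * node_functional g"
  by (simp add: node_functional_def mixed_difference_def algebra_simps)

lemma node_functional_cong:
  assumes "\<And>\<xi>. \<xi> \<in> gauss_points 4 \<Longrightarrow> f \<xi> = g \<xi>"
  shows "node_functional f = node_functional g"
proof -
  \<comment> \<open>The bound with \<open>B = 0\<close>, applied to the difference.\<close>
  have "\<bar>node_functional (\<lambda>x. f x - g x)\<bar> \<le> 16 * 0"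
    by (rule node_functional_bound) (simp add: assms)
  then show ?thesis by (simp add: node_functional_def mixed_difference_def)
qed

text \<open>The sum factorises over the coordinates. In the first, a constant cancels between outer
  and inner nodes and an odd power between opposite nodes, so a nonzero value needs
  \<open>m$1 = 3\<close>, and then both other exponents must be 1. The value is 3 * 2 (gl_out^2 -
  gl_in^2) * (2 gl_out)^2.\<close>

lemma node_functional_grad:
  assumes "m \<in> S3_exps"
  shows "node_functional (\<lambda>\<xi>. monomial_grad m \<xi> $ 1) = (if m = m311 then 24 * K_G else 0)"
proof -
  have md: "mixed_difference (\<lambda>\<xi>. monomial_grad m \<xi> $ 1) r
      = real (m$1) * r^(m$1 - 1) * (gl_out^(m$2) - (- gl_out)^(m$2)) * (gl_out^(m$3) - (- gl_out)^(m$3))" for r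
    by (simp add: mixed_difference_def monomial_grad_def algebra_simps)
  have nf: "node_functional (\<lambda>\<xi>. monomial_grad m \<xi> $ 1)
      = real (m$1) * (gl_out^(m$1 - 1) + (- gl_out)^(m$1 - 1) - gl_in^(m$1 - 1) - (- gl_in)^(m$1 - 1))
        * (gl_out^(m$2) - (- gl_out)^(m$2)) * (gl_out^(m$3) - (- gl_out)^(m$3))"
    unfolding node_functional_def md by (simp add: algebra_simps)
  show ?thesis
  proof (cases "m = m311")
    case True
    have "node_functional (\<lambda>\<xi>. monomial_grad m \<xi> $ 1) = 24 * (gl_out^2 * (gl_out^2 - gl_in^2))"
      unfolding nf unfolding True by (simp add: power2_eq_square algebra_simps)
    then show ?thesis using True by (simp add: K_G_gl)
  next
    case False
    have "m$1 \<le> 3" using assms S3_exps_subset_Q3_exps by (auto simp: Q3_exps_def)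
    then consider "m$1 = 0" | "m$1 = 1" | "m$1 = 2" | "m$1 = 3" by linarith
    then have "node_functional (\<lambda>\<xi>. monomial_grad m \<xi> $ 1) = 0"
    proof cases
      case 4
      then have "m$2 \<le> 1" "m$3 \<le> 1" using assms by (auto simp: S3_exps_iff split: if_splits)
      then have "m$2 = 0 \<or> m$3 = 0" using False 4 by (auto simp: vec_eq_iff forall_3)
      then show ?thesis by (auto simp: nf)
    qed (simp_all add: nf)
    then show ?thesis using False by simp
  qed
qed

text \<open>A trace-free stretch and an infinitesimal rotation in the plane of axes 2 and 3 have
  cofactors -e_1 e_1^T and e_1 e_1^T; their ratios bound the entry from above and below.\<close>

lemma R_11_bound:
  assumes mat: "material N c c1 c2" and e: "e \<in> cells N" and \<xi>: "\<xi> \<in> gauss_points 4"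
  shows "\<bar>R_field N \<alpha> z e \<xi> $ 1 $ 1 - 2 * c\<bar> \<le> 2 * (c - margin N \<alpha> c1 c2 z)"
proof -
  let ?R = "R_field N \<alpha> z e \<xi>"
  define H1 :: "real^3^3" where "H1 = vector [vector [0, 0, 0], vector [0, 1, 0], vector [0, 0, -1]]"
  define H2 :: "real^3^3" where "H2 = vector [vector [0, 0, 0], vector [0, 0, 1], vector [0, -1, 0]]"
  have "H1$2$2 \<noteq> 0" "H2$2$3 \<noteq> 0" by (simp_all add: H1_def H2_def)
  then have ne: "H1 \<noteq> 0" "H2 \<noteq> 0" by auto
  have "margin_ratio (c1 e) (c2 e) ?R H1 = (8 * c - 2 * ?R$1$1) / 4"
    unfolding margin_ratio_def hess_iso_eq A_form_eq mdot_inner mcross_self material_sum[OF mat e]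
    by (simp add: inner_33 trace_def sum_3 matrix_matrix_mult_def H1_def cof_def)
  moreover have "margin_ratio (c1 e) (c2 e) ?R H2 = 2 * ?R$1$1 / 4"
    unfolding margin_ratio_def hess_iso_eq A_form_eq mdot_inner mcross_self material_sum[OF mat e]
    by (simp add: inner_33 trace_def sum_3 matrix_matrix_mult_def H2_def cof_def)
  ultimately show ?thesis
    using margin_le[OF mat e \<xi> ne(1), of \<alpha> z] margin_le[OF mat e \<xi> ne(2), of \<alpha> z] by simp
qed

text \<open>At Gauss points the first derivative of z_1 is close to \<open>2 * c\<close> times that
  of the first component of the cell map, up to the margin deficit. The signed sum annihilates the
  former and yields 24 K_G \<alpha> h/2 on the latter. Division by the 16 points turns 2 * 24 into
  the factor 3.\<close>

lemma margin_Z_Q_le: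
  assumes N: "N \<ge> 1" and mat: "material N c c1 c2" and \<alpha>: "\<bar>\<alpha>\<bar> < 1/3" and z: "z \<in> Z_Q N \<alpha>"
  shows "3 * c * K_G * \<bar>\<alpha>\<bar> \<le> 2 * (1 + 3 * \<bar>\<alpha>\<bar>) * (c - margin N \<alpha> c1 c2 z)"
proof -
  \<comment> \<open>A single cell suffices; this one exists for every \<open>N\<close> and has sign
    1.\<close>
  let ?e = "0 :: nat^3"
  note e = zero_in_cells[OF N]
  let ?h = "1 / real N / 2"
  let ?g = "margin N \<alpha> c1 c2 z"
  have h: "?h > 0" using N by simp
  have c: "c > 0" using mat by (simp add: material_def)
  have g: "?g \<le> c" by (rule margin_le_c[OF N mat])
  obtain a where a: "\<And>\<eta> i. \<eta> \<in> ref_cube \<Longrightarrow> z (geom N \<alpha> ?e \<eta>) $ i = (\<Sum>m\<in>S3_exps. a i m * monomial m \<eta>)"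
    and a0: "a 1 m311 = 0" using Z_Q_top_coefficient[OF z e] by blast
  let ?D = "\<lambda>\<xi>. parent_D (\<lambda>\<eta>. z (geom N \<alpha> ?e \<eta>)) \<xi> $ 1 $ 1"
  \<comment> \<open>Multiplying R_z back by the Jacobian brings in only its (1,1) entry, because the
    first column of a shear vanishes below the diagonal.\<close>
  have D_R: "?D \<xi> = R_field N \<alpha> z ?e \<xi> $ 1 $ 1 * (?h * (1 + bump \<alpha> ?e \<xi> $ 1))" if \<xi>: "\<xi> \<in> ref_cube" for \<xi>
  proof -
    let ?DX = "parent_D (geom N \<alpha> ?e) \<xi>"
    have "1 + bump \<alpha> ?e \<xi> $ 1 \<noteq> 0" using bump_1_bound[OF \<xi>, of \<alpha> ?e] \<alpha> by linarith
    then have "matrix_inv ?DX ** ?DX = mat 1"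
      unfolding matrix_inv_geom[OF N \<xi> \<alpha>]
      unfolding parent_D_geom[OF \<xi>] matrix_mult_scaleR
      using shear_inverse(2)[of "bump \<alpha> ?e \<xi>"] N by simp
    then have "parent_D (\<lambda>\<eta>. z (geom N \<alpha> ?e \<eta>)) \<xi> = R_field N \<alpha> z ?e \<xi> ** ?DX"
      unfolding R_field_def matrix_mul_assoc[symmetric] by (simp only: matrix_mul_rid)
    then show ?thesis
      unfolding parent_D_geom[OF \<xi>]
      by (simp only: matrix_matrix_mult_def sum_3 vec_lambda_beta vector_scaleR_component shear_nth) simp
  qed
  have "node_functional ?D = node_functional (\<lambda>\<xi>. \<Sum>m\<in>S3_exps. a 1 m * (monomial_grad m \<xi> $ 1))"
    by (rule node_functional_cong)
      (simp add: parent_D_polynomial[where f = "\<lambda>\<eta>. z (geom N \<alpha> ?e \<eta>)", OF a gauss_points4_ref_cube])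
  also have "\<dots> = (\<Sum>m\<in>S3_exps. a 1 m * (if m = m311 then 24 * K_G else 0))"
    unfolding node_functional_sum by (intro sum.cong refl) (simp add: node_functional_grad)
  also have "\<dots> = 0"
    using a0 by (intro sum.neutral) auto
  finally have nD: "node_functional ?D = 0" .
  have nb: "node_functional (\<lambda>\<xi>. bump \<alpha> ?e \<xi> $ 1) = \<alpha> * (24 * K_G)"
    using node_functional_sum[of "\<lambda>_. \<alpha>" "\<lambda>_ \<xi>. monomial_grad m311 \<xi> $ 1" "{()}"]
    by (simp add: bump_def cell_sign_def node_functional_grad S3_exps_members)
  have "node_functional (\<lambda>\<xi>. ?D \<xi> - 2 * c * (?h * (1 + bump \<alpha> ?e \<xi> $ 1)))
     = node_functional ?D - 2 * c * ?h * node_functional (\<lambda>\<xi>. bump \<alpha> ?e \<xi> $ 1)"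
    by (rule node_functional_affine)
  also have "\<dots> = - (2 * c * ?h * (\<alpha> * (24 * K_G)))" by (simp add: nD nb)
  finally have n: "\<bar>node_functional (\<lambda>\<xi>. ?D \<xi> - 2 * c * (?h * (1 + bump \<alpha> ?e \<xi> $ 1)))\<bar>
      = 2 * c * ?h * (\<bar>\<alpha>\<bar> * (24 * K_G))"
    using c K_G_pos by (simp add: abs_mult)
  have "\<bar>node_functional (\<lambda>\<xi>. ?D \<xi> - 2 * c * (?h * (1 + bump \<alpha> ?e \<xi> $ 1)))\<bar>
      \<le> 16 * (2 * (c - ?g) * (?h * (1 + 3 * \<bar>\<alpha>\<bar>)))"
  proof (rule node_functional_bound)
    fix \<xi> :: "real^3" assume \<xi>: "\<xi> \<in> gauss_points 4"
    note \<xi>c = gauss_points4_ref_cube[OF \<xi>]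
    have b: "\<bar>?h * (1 + bump \<alpha> ?e \<xi> $ 1)\<bar> \<le> ?h * (1 + 3 * \<bar>\<alpha>\<bar>)"
      unfolding abs_mult using h bump_1_bound[OF \<xi>c, of \<alpha> ?e]
      by (intro mult_mono) auto
    have "?D \<xi> - 2 * c * (?h * (1 + bump \<alpha> ?e \<xi> $ 1))
        = (R_field N \<alpha> z ?e \<xi> $ 1 $ 1 - 2 * c) * (?h * (1 + bump \<alpha> ?e \<xi> $ 1))"
      unfolding D_R[OF \<xi>c] left_diff_distrib ..
    then have "\<bar>?D \<xi> - 2 * c * (?h * (1 + bump \<alpha> ?e \<xi> $ 1))\<bar>
        = \<bar>R_field N \<alpha> z ?e \<xi> $ 1 $ 1 - 2 * c\<bar> * \<bar>?h * (1 + bump \<alpha> ?e \<xi> $ 1)\<bar>"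
      by (simp only: abs_mult)
    also have "\<dots> \<le> 2 * (c - ?g) * (?h * (1 + 3 * \<bar>\<alpha>\<bar>))"
      using g by (intro mult_mono R_11_bound[OF mat e \<xi>] b) auto
    finally show "\<bar>?D \<xi> - 2 * c * (?h * (1 + bump \<alpha> ?e \<xi> $ 1))\<bar> \<le> 2 * (c - ?g) * (?h * (1 + 3 * \<bar>\<alpha>\<bar>))" .
  qed
  then have "(16 * ?h) * (3 * c * K_G * \<bar>\<alpha>\<bar>) \<le> (16 * ?h) * (2 * (1 + 3 * \<bar>\<alpha>\<bar>) * (c - ?g))"
    unfolding n by (simp only: ac_simps)
  then show ?thesis using h by (simp only: mult_le_cancel_left_pos)
qed

section \<open>Existence of a maximiser\<close>

text \<open>Bolzano-Weierstrass, passing to a further subsequence for each index.\<close>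

lemma pointwise_convergent_subsequence:
  fixes f :: "nat \<Rightarrow> 'i \<Rightarrow> real"
  assumes "finite I" "\<And>i. i \<in> I \<Longrightarrow> bounded (range (\<lambda>n. f n i))"
  shows "\<exists>r g. strict_mono (r :: nat \<Rightarrow> nat) \<and> (\<forall>i\<in>I. (\<lambda>n. f (r n) i) \<longlonglongrightarrow> g i)"
  using assms
proof (induction I rule: finite_induct)
  case empty
  show ?case using strict_mono_id by auto
next
  case (insert j I)
  then obtain r g where r: "strict_mono (r :: nat \<Rightarrow> nat)" "\<forall>i\<in>I. (\<lambda>n. f (r n) i) \<longlonglongrightarrow> g i" by auto
  have "bounded (range (\<lambda>n. f (r n) j))"
    by (rule bounded_subset[OF insert.prems[of j]]) auto
  then obtain l s where s: "strict_mono (s :: nat \<Rightarrow> nat)" "((\<lambda>n. f (r n) j) \<circ> s) \<longlonglongrightarrow> l"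
    using bounded_imp_convergent_subsequence by blast
  have "(\<lambda>n. f (r (s n)) i) \<longlonglongrightarrow> (g(j := l)) i" if "i \<in> insert j I" for i
  proof (cases "i = j")
    case True
    then show ?thesis using s(2) by (simp add: o_def)
  next
    case False
    then have "((\<lambda>n. f (r n) i) \<circ> s) \<longlonglongrightarrow> g i" using r(2) that s(1) by (intro LIMSEQ_subseq_LIMSEQ) auto
    then show ?thesis using False by (simp add: o_def)
  qed
  then show ?case using strict_mono_compose[OF r(1) s(1)]
    by (intro exI[of _ "\<lambda>n. r (s n)"] exI[of _ "g(j := l)"]) auto
qed

text \<open>Finite-dimensional subspaces are closed; the space is given by the coordinates \<open>v w i\<close>
  with \<open>i\<close> in a finite set that depends on the number of cells, hence is not a type.
  Each step of the induction eliminates one coordinate.\<close>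

lemma subspace_pointwise_closed:
  fixes v :: "'z \<Rightarrow> 'i \<Rightarrow> real"
  assumes "finite I"
    and "\<And>x y a. x \<in> Z \<Longrightarrow> y \<in> Z \<Longrightarrow> \<exists>w\<in>Z. \<forall>i\<in>I. v w i = v x i + a * v y i"
    and "\<And>n. f n \<in> Z" and "\<And>i. i \<in> I \<Longrightarrow> (\<lambda>n. v (f n) i) \<longlonglongrightarrow> g i"
  shows "\<exists>w\<in>Z. \<forall>i\<in>I. v w i = g i"
  using assms
proof (induction I arbitrary: Z f g rule: finite_induct)
  case empty
  then show ?case by blast
next
  case (insert j I)
  show ?case
  proof (cases "\<exists>y\<in>Z. v y j \<noteq> 0")
    case False
    have "\<exists>w\<in>Z. \<forall>i\<in>I. v w i = g i"
    proof (rule insert.IH[of Z f])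
      show "\<exists>w\<in>Z. \<forall>i\<in>I. v w i = v x i + a * v y i" if "x \<in> Z" "y \<in> Z" for x y a
        using insert.prems(1)[OF that] by blast
    qed (use insert.prems in auto)
    moreover have "(\<lambda>n. 0) \<longlonglongrightarrow> g j"
      using insert.prems(3)[of j] insert.prems(2) False by simp
    then have "g j = 0" using LIMSEQ_unique tendsto_const by blast
    ultimately show ?thesis using False by auto
  next
    case True
    then obtain y where y: "y \<in> Z" "v y j \<noteq> 0" by blast
    let ?Z = "{w\<in>Z. v w j = 0}"
    \<comment> \<open>Subtracting a multiple of \<open>y\<close> moves the sequence into the
      subspace where coordinate \<open>j\<close> vanishes; the multiples converge together with that
      coordinate.\<close>
    have "\<forall>n. \<exists>w\<in>Z. \<forall>i\<in>insert j I. v w i = v (f n) i + (- (v (f n) j / v y j)) * v y i"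
      using insert.prems(1)[OF insert.prems(2) y(1)] by blast
    then obtain f' where f': "\<And>n. f' n \<in> Z"
      "\<And>n i. i \<in> insert j I \<Longrightarrow> v (f' n) i = v (f n) i + (- (v (f n) j / v y j)) * v y i" by metis
    have "\<exists>w\<in>?Z. \<forall>i\<in>I. v w i = g i + (- (g j / v y j)) * v y i"
    proof (rule insert.IH[of ?Z f'])
      show "f' n \<in> ?Z" for n using f'(1) f'(2)[of j n] y(2) by simp
      show "\<exists>w\<in>?Z. \<forall>i\<in>I. v w i = v x i + a * v y' i" if "x \<in> ?Z" "y' \<in> ?Z" for x y' a
        using insert.prems(1)[of x y' a] that by auto
      show "(\<lambda>n. v (f' n) i) \<longlonglongrightarrow> g i + (- (g j / v y j)) * v y i" if "i \<in> I" for i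
      proof -
        have "v (f' n) i = v (f n) i + (- (v (f n) j / v y j)) * v y i" for n
          using that by (intro f'(2)) simp
        then show ?thesis
          using that y(2) by (simp only:) (intro tendsto_intros insert.prems(3); simp)
      qed
    qed
    then obtain w where w: "w \<in> Z" "v w j = 0" "\<forall>i\<in>I. v w i = g i + (- (g j / v y j)) * v y i" by blast
    \<comment> \<open>The limit multiple of \<open>y\<close> is added back, which restores
      coordinate \<open>j\<close>.\<close>
    from insert.prems(1)[OF w(1) y(1), of "g j / v y j"] obtain w' where
      "w' \<in> Z" "\<forall>i\<in>insert j I. v w' i = v w i + g j / v y j * v y i" by blast
    then show ?thesis using w y(2) by (intro bexI[of _ w']) auto
  qed
qed

text \<open>Supplies the linearity hypothesis of \<open>subspace_pointwise_closed\<close> for the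
  values of R_z at the Gauss points.\<close>

lemma exact_class_combination:
  assumes x: "x \<in> exact_class M N \<alpha>" and y: "y \<in> exact_class M N \<alpha>" and M: "finite M"
  shows "(\<lambda>p. x p + a *\<^sub>R y p) \<in> exact_class M N \<alpha>"
    and "e \<in> cells N \<Longrightarrow> \<xi> \<in> ref_cube \<Longrightarrow>
      R_field N \<alpha> (\<lambda>p. x p + a *\<^sub>R y p) e \<xi> = R_field N \<alpha> x e \<xi> + a *\<^sub>R R_field N \<alpha> y e \<xi>"
proof -
  let ?w = "\<lambda>p. x p + a *\<^sub>R y p"
  have coeff: "\<exists>b. \<forall>\<eta>\<in>ref_cube. \<forall>i. z (geom N \<alpha> e \<eta>) $ i = (\<Sum>m\<in>S3_exps. b i m * monomial m \<eta>)"
    if z: "z \<in> exact_class M N \<alpha>" and e: "e \<in> cells N" for z e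
  proof -
    obtain p where p: "p \<in> vector_span S3_exps" "\<forall>\<xi>\<in>ref_cube. z (geom N \<alpha> e \<xi>) = p \<xi>"
      using z e by (auto simp: exact_class_def candidates_def)
    then show ?thesis using vector_spanD[OF p(1)] by metis
  qed
  have D: "parent_D (\<lambda>\<eta>. ?w (geom N \<alpha> e \<eta>)) \<xi>
      = parent_D (\<lambda>\<eta>. x (geom N \<alpha> e \<eta>)) \<xi> + a *\<^sub>R parent_D (\<lambda>\<eta>. y (geom N \<alpha> e \<eta>)) \<xi>"
    if e: "e \<in> cells N" and \<xi>: "\<xi> \<in> ref_cube" for e \<xi>
  proof -
    obtain b where b: "\<And>\<eta> i. \<eta>\<in>ref_cube \<Longrightarrow> x (geom N \<alpha> e \<eta>) $ i = (\<Sum>m\<in>S3_exps. b i m * monomial m \<eta>)"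
      using coeff[OF x e] by blast
    obtain d where d: "\<And>\<eta> i. \<eta>\<in>ref_cube \<Longrightarrow> y (geom N \<alpha> e \<eta>) $ i = (\<Sum>m\<in>S3_exps. d i m * monomial m \<eta>)"
      using coeff[OF y e] by blast
    have bd: "?w (geom N \<alpha> e \<eta>) $ i = (\<Sum>m\<in>S3_exps. (b i m + a * d i m) * monomial m \<eta>)" if "\<eta> \<in> ref_cube" for \<eta> i
      by (simp add: b[OF that] d[OF that] sum_distrib_left sum.distrib distrib_right mult.assoc)
    show ?thesis
      using parent_D_polynomial[of _ b, OF b \<xi>] parent_D_polynomial[of _ d, OF d \<xi>]
        parent_D_polynomial[of _ "\<lambda>i m. b i m + a * d i m", OF bd \<xi>]
      by (simp add: vec_eq_iff scaleR_add_left sum.distrib sum_distrib_left mult.assoc distrib_right)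
  qed
  show "e \<in> cells N \<Longrightarrow> \<xi> \<in> ref_cube \<Longrightarrow>
      R_field N \<alpha> ?w e \<xi> = R_field N \<alpha> x e \<xi> + a *\<^sub>R R_field N \<alpha> y e \<xi>"
    unfolding R_field_def D
    by (simp add: vec_eq_iff matrix_matrix_mult_def sum_distrib_left sum.distrib algebra_simps)
  show "?w \<in> exact_class M N \<alpha>"
    unfolding exact_class_def candidates_def
  proof (intro CollectI conjI ballI)
    show "continuous_on (closure (domain_h N \<alpha>)) ?w"
      using x y by (intro continuous_intros) (auto simp: exact_class_def candidates_def)
  next
    fix e assume e: "e \<in> cells N"
    obtain b where b: "\<forall>\<eta>\<in>ref_cube. \<forall>i. x (geom N \<alpha> e \<eta>) $ i = (\<Sum>m\<in>S3_exps. b i m * monomial m \<eta>)"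
      using coeff[OF x e] by blast
    obtain d where d: "\<forall>\<eta>\<in>ref_cube. \<forall>i. y (geom N \<alpha> e \<eta>) $ i = (\<Sum>m\<in>S3_exps. d i m * monomial m \<eta>)"
      using coeff[OF y e] by blast
    have bd: "?w (geom N \<alpha> e \<eta>) $ i = (\<Sum>m\<in>S3_exps. (b i m + a * d i m) * monomial m \<eta>)" if "\<eta> \<in> ref_cube" for \<eta> i
      using b d that by (simp add: sum_distrib_left sum.distrib distrib_right mult.assoc)
    let ?p = "\<lambda>\<eta>. \<chi> i. \<Sum>m\<in>S3_exps. (b i m + a * d i m) * monomial m \<eta>"
    have "?p \<in> vector_span S3_exps" by (auto simp: vector_span_def monomial_span_def)
    then show "\<exists>p\<in>vector_span S3_exps. \<forall>\<xi>\<in>ref_cube. ?w (geom N \<alpha> e \<xi>) = p \<xi>"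
      using bd by (intro bexI[of _ ?p]) (auto simp: vec_eq_iff)
    fix u v assume u: "u \<in> vector_span M" and v: "v \<in> vector_span M"
    obtain b' where b': "\<forall>x i. u x $ i = (\<Sum>m\<in>M. b' i m * monomial m x)" using vector_spanD[OF u] by blast
    obtain c' where c': "\<forall>x i. v x $ i = (\<Sum>m\<in>M. c' i m * monomial m x)" using vector_spanD[OF v] by blast
    \<comment> \<open>With the test fields fixed, the defect as a linear function of the
      coefficients of the potential.\<close>
    let ?q = "\<lambda>k. \<Sum>(m, n, l)\<in>S3_exps \<times> M \<times> M.
      (k 1 m * (b' 2 n * c' 3 l - b' 3 n * c' 2 l) + k 2 m * (b' 3 n * c' 1 l - b' 1 n * c' 3 l)
       + k 3 m * (b' 1 n * c' 2 l - b' 2 n * c' 1 l)) * triple_error m n l"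
    have q: "quad_defect w u v = ?q k"
      if "\<And>\<eta> i. \<eta> \<in> ref_cube \<Longrightarrow> w \<eta> $ i = (\<Sum>m\<in>S3_exps. k i m * monomial m \<eta>)" for w k
      by (rule quad_defect_polynomial[OF finite_S3_exps M M]) (use that b' c' in auto)
    have qw: "quad_defect (\<lambda>\<xi>. ?w (geom N \<alpha> e \<xi>)) u v = ?q (\<lambda>i m. b i m + a * d i m)"
      by (rule q[OF bd])
    have qx: "quad_defect (\<lambda>\<xi>. x (geom N \<alpha> e \<xi>)) u v = ?q b"
      by (rule q) (use b in blast)
    have qy: "quad_defect (\<lambda>\<xi>. y (geom N \<alpha> e \<xi>)) u v = ?q d"
      by (rule q) (use d in blast)
    have "quad_defect (\<lambda>\<xi>. ?w (geom N \<alpha> e \<xi>)) u v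
        = quad_defect (\<lambda>\<xi>. x (geom N \<alpha> e \<xi>)) u v + a * quad_defect (\<lambda>\<xi>. y (geom N \<alpha> e \<xi>)) u v"
      unfolding qw qx qy sum_distrib_left sum.distrib[symmetric]
      by (intro sum.cong refl) (auto simp: algebra_simps)
    also have "\<dots> = 0" using x y e u v by (simp add: exact_class_def)
    finally show "quad_defect (\<lambda>\<xi>. ?w (geom N \<alpha> e \<xi>)) u v = 0" .
  qed
qed

text \<open>Two nonzero entries on a diagonal of the complementary 2 by 2 block leave a single
  cofactor; the sign of the second entry offsets the cofactor sign.\<close>

lemma cofactor_unit:
  fixes i j :: 3 and t :: real
  shows "\<exists>H. H \<noteq> 0 \<and> cof H = t *\<^sub>R axis i (axis j 1)"
proof -
  define P :: "3 \<Rightarrow> 3 \<Rightarrow> 3 \<Rightarrow> 3 \<Rightarrow> real \<Rightarrow> real^3^3" where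
    "P a b k l s = (\<chi> r q. if r = a \<and> q = b then 1 else if r = k \<and> q = l then s else 0)" for a b k l s
  have ne: "P a b k l s \<noteq> 0" for a b k l s
  proof -
    have "P a b k l s $ a $ b \<noteq> 0" by (simp add: P_def)
    then show ?thesis by auto
  qed
  have ax: "(axis j x :: ('a::zero)^3) $ i = (if i = j then x else 0)" for i j x by (simp add: axis_def)
  have "cof (P 2 2 3 3 t) = t *\<^sub>R axis 1 (axis 1 1)" "cof (P 2 1 3 3 (-t)) = t *\<^sub>R axis 1 (axis 2 1)"
    "cof (P 2 1 3 2 t) = t *\<^sub>R axis 1 (axis 3 1)" "cof (P 1 2 3 3 (-t)) = t *\<^sub>R axis 2 (axis 1 1)"
    "cof (P 1 1 3 3 t) = t *\<^sub>R axis 2 (axis 2 1)" "cof (P 1 1 3 2 (-t)) = t *\<^sub>R axis 2 (axis 3 1)"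
    "cof (P 1 2 2 3 t) = t *\<^sub>R axis 3 (axis 1 1)" "cof (P 1 1 2 3 (-t)) = t *\<^sub>R axis 3 (axis 2 1)"
    "cof (P 1 1 2 2 t) = t *\<^sub>R axis 3 (axis 3 1)"
    by (simp_all add: vec_eq_iff forall_3 cof_def P_def ax)
  then show ?thesis using exhaust_3[of i] exhaust_3[of j] ne by metis
qed

lemma R_field_entry_bound:
  assumes mat: "material N c c1 c2"
  shows "\<exists>K. \<forall>z e \<xi>. e \<in> cells N \<longrightarrow> \<xi> \<in> gauss_points 4 \<longrightarrow> m \<le> margin N \<alpha> c1 c2 z \<longrightarrow>
    \<bar>R_field N \<alpha> z e \<xi> $ i $ j\<bar> \<le> K"
proof -
  obtain H where H: "H \<noteq> 0" "cof H = 1 *\<^sub>R axis i (axis j 1)" using cofactor_unit by blast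
  obtain H' where H': "H' \<noteq> 0" "cof H' = (-1) *\<^sub>R axis i (axis j 1)" using cofactor_unit by blast
  \<comment> \<open>By \<open>hess_iso_eq\<close> the Hessian is the same in all cells, so the bound
    depends neither on the cell nor on the field.\<close>
  let ?h = "\<lambda>H. c * (2 * (H \<bullet> H) + 2 * trace (H ** H) - 4/3 * (trace H)^2)"
  let ?K = "\<lambda>H. \<bar>?h H - m * A_form H H\<bar>"
  have "\<bar>R_field N \<alpha> z e \<xi> $ i $ j\<bar> \<le> ?K H + ?K H'"
    if e: "e \<in> cells N" and \<xi>: "\<xi> \<in> gauss_points 4" and m: "m \<le> margin N \<alpha> c1 c2 z" for z e \<xi>
  proof -
    let ?R = "R_field N \<alpha> z e \<xi>"
    have inner: "?R \<bullet> axis i (axis j 1) = ?R $ i $ j" by (simp add: inner_axis)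
    have b: "m * A_form G G \<le> ?h G + 2 * (?R \<bullet> cof G)" if "G \<noteq> 0" for G
    proof -
      have "m \<le> margin_ratio (c1 e) (c2 e) ?R G" using margin_le[OF mat e \<xi> that, of \<alpha> z] m by linarith
      then show ?thesis
        using A_form_pos[OF that]
        by (simp add: margin_ratio_def pos_le_divide_eq mdot_inner mcross_self hess_iso_eq material_sum[OF mat e])
    qed
    from b[OF H(1)] b[OF H'(1)] show ?thesis
      unfolding H(2) H'(2) inner_scaleR_right inner by linarith
  qed
  then show ?thesis by blast
qed

text \<open>Compactness is applied to the values of R_z at the Gauss points, which determine the
  margin. They converge along a subsequence of a maximising sequence, and closedness of the subspace
  of attainable values provides a field with the limit values.\<close>

lemma Z_Q_maximiser:
  assumes N: "N \<ge> 1" and mat: "material N c c1 c2" and \<alpha>: "\<bar>\<alpha>\<bar> < 1/3"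
  shows "\<exists>z\<in>Z_Q N \<alpha>. margin N \<alpha> c1 c2 z = best_margin Z_Q N \<alpha> c1 c2"
    and "z' \<in> Z_Q N \<alpha> \<Longrightarrow> margin N \<alpha> c1 c2 z' \<le> best_margin Z_Q N \<alpha> c1 c2"
proof -
  let ?Z = "Z_Q N \<alpha>" and ?m = "margin N \<alpha> c1 c2" and ?S = "best_margin Z_Q N \<alpha> c1 c2"
  have bdd: "bdd_above (?m ` ?Z)" using margin_le_c[OF N mat] by (intro bdd_aboveI2)
  then show upper: "z' \<in> ?Z \<Longrightarrow> ?m z' \<le> ?S" for z'
    unfolding best_margin_def by (rule cSUP_upper2) auto
  have ne: "?Z \<noteq> {}" using inverse_field_in_Z_Q[OF N \<alpha>] by blast
  have "\<exists>z\<in>?Z. ?S - 1 / real (Suc n) < ?m z" for n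
  proof -
    have "?S - 1 / real (Suc n) < (SUP z\<in>?Z. ?m z)" by (simp add: best_margin_def)
    then show ?thesis using less_cSUP_iff[OF ne bdd] by blast
  qed
  then obtain f where f: "\<And>n. f n \<in> ?Z" "\<And>n. ?S - 1 / real (Suc n) < ?m (f n)" by metis
  define v where "v = (\<lambda>z (e, \<xi>, i, j). R_field N \<alpha> z e \<xi> $ i $ j)"
  let ?I = "cells N \<times> gauss_points 4 \<times> (UNIV :: 3 set) \<times> (UNIV :: 3 set)"
  have fin: "finite ?I" by (simp add: finite_cells finite_gauss_points4)
  have "bounded (range (\<lambda>n. v (f n) x))" if x: "x \<in> ?I" for x
  proof -
    obtain e \<xi> i j where x': "x = (e, \<xi>, i, j)" by (cases x) auto
    obtain K where K: "\<forall>z e \<xi>. e \<in> cells N \<longrightarrow> \<xi> \<in> gauss_points 4 \<longrightarrow> ?S - 1 \<le> ?m z \<longrightarrow>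
      \<bar>R_field N \<alpha> z e \<xi> $ i $ j\<bar> \<le> K" using R_field_entry_bound[OF mat] by blast
    \<comment> \<open>A common level below all margins of the sequence, so that one bound
      \<open>K\<close> serves every index.\<close>
    have "?S - 1 \<le> ?m (f n)" for n
    proof -
      have "1 / real (Suc n) \<le> 1" by simp
      then show ?thesis using f(2)[of n] by linarith
    qed
    then have "norm (v (f n) x) \<le> K" for n using K x by (auto simp: v_def x')
    then show ?thesis by (auto simp: bounded_iff)
  qed
  from pointwise_convergent_subsequence[of ?I "\<lambda>n. v (f n)", OF fin this]
  obtain r g where r: "strict_mono (r :: nat \<Rightarrow> nat)" "\<forall>x\<in>?I. (\<lambda>n. v (f (r n)) x) \<longlonglongrightarrow> g x" by blast
  have "\<exists>w\<in>?Z. \<forall>x\<in>?I. v w x = g x"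
  proof (rule subspace_pointwise_closed[OF fin])
    show "\<exists>w\<in>?Z. \<forall>k\<in>?I. v w k = v x k + a * v y k" if "x \<in> ?Z" "y \<in> ?Z" for x y a
      using exact_class_combination[OF that finite_Q3_exps] gauss_points4_ref_cube
      by (intro bexI[of _ "\<lambda>p. x p + a *\<^sub>R y p"]) (auto simp: v_def)
    show "f (r n) \<in> ?Z" for n by (rule f(1))
    show "(\<lambda>n. v (f (r n)) x) \<longlonglongrightarrow> g x" if "x \<in> ?I" for x using r(2) that by blast
  qed
  then obtain w where w: "w \<in> ?Z" "\<And>x. x \<in> ?I \<Longrightarrow> v w x = g x" by blast
  have "?S \<le> ?m w"
  proof (rule margin_ge[OF N])
    fix e \<xi> and H :: "real^3^3" assume e: "e \<in> cells N" "\<xi> \<in> gauss_points 4" "H \<noteq> 0"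
    have "(\<lambda>n. R_field N \<alpha> (f (r n)) e \<xi>) \<longlonglongrightarrow> R_field N \<alpha> w e \<xi>"
    proof (intro vec_tendstoI)
      fix i j
      have x: "(e, \<xi>, i, j) \<in> ?I" using e by simp
      show "(\<lambda>n. R_field N \<alpha> (f (r n)) e \<xi> $ i $ j) \<longlonglongrightarrow> R_field N \<alpha> w e \<xi> $ i $ j"
        using r(2)[rule_format, OF x] w(2)[OF x] by (simp add: v_def)
    qed
    \<comment> \<open>For fixed \<open>H\<close> the ratio is affine in R_z, so the limit is taken
      ratio by ratio and the margin is reassembled by \<open>margin_ge\<close>.\<close>
    then have lim: "(\<lambda>n. margin_ratio (c1 e) (c2 e) (R_field N \<alpha> (f (r n)) e \<xi>) H)
        \<longlonglongrightarrow> margin_ratio (c1 e) (c2 e) (R_field N \<alpha> w e \<xi>) H"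
      unfolding margin_ratio_def mdot_inner using A_form_pos[OF e(3)]
      by (intro tendsto_intros) auto
    have "(\<lambda>n. 1 / real (Suc n)) \<longlonglongrightarrow> 0" using LIMSEQ_inverse_real_of_nat by (simp add: inverse_eq_divide)
    then have "((\<lambda>n. ?S - 1 / real (Suc n)) \<circ> r) \<longlonglongrightarrow> ?S - 0"
      using r(1) by (intro LIMSEQ_subseq_LIMSEQ tendsto_intros)
    then have "(\<lambda>n. ?S - 1 / real (Suc (r n))) \<longlonglongrightarrow> ?S" by (simp add: o_def)
    moreover have "?S - 1 / real (Suc (r n)) \<le> margin_ratio (c1 e) (c2 e) (R_field N \<alpha> (f (r n)) e \<xi>) H" for n
      using f(2)[of "r n"] margin_le[OF mat e, of \<alpha> "f (r n)"] by linarith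
    ultimately show "?S \<le> margin_ratio (c1 e) (c2 e) (R_field N \<alpha> w e \<xi>) H"
      using lim by (intro LIMSEQ_le) auto
  qed
  then show "\<exists>z\<in>?Z. ?m z = ?S" using w(1) upper[OF w(1)] by (intro bexI[of _ w]) auto
qed

section \<open>The optimal margins\<close>

lemma best_margin_Z_S:
  assumes "N \<ge> 1" "material N c c1 c2" "\<bar>\<alpha>\<bar> < 1/3"
  shows "best_margin Z_S N \<alpha> c1 c2 = c"
  unfolding best_margin_def
  using margin_identity[OF assms] identity_in_Z_S margin_le_c[OF assms(1,2)]
  by (intro cSup_eq_maximum) (auto intro!: image_eqI[of _ _ "\<lambda>x. (2 * c) *\<^sub>R x"])

lemma amplitude_bounds:
  assumes "\<bar>\<alpha>\<bar> < 1 / (3 * sqrt 11)"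
  shows "3 * (sqrt 11 * \<bar>\<alpha>\<bar>) < 1" "3 * \<bar>\<alpha>\<bar> \<le> sqrt 11 * \<bar>\<alpha>\<bar>" "\<bar>\<alpha>\<bar> < 1/3"
proof -
  have s11: "3 \<le> sqrt 11" by (simp add: real_le_rsqrt)
  show 1: "3 * (sqrt 11 * \<bar>\<alpha>\<bar>) < 1" using assms by (simp add: field_simps)
  show 2: "3 * \<bar>\<alpha>\<bar> \<le> sqrt 11 * \<bar>\<alpha>\<bar>" using s11 by (intro mult_right_mono) auto
  show "\<bar>\<alpha>\<bar> < 1/3" using 1 2 by linarith
qed

lemma best_margin_Z_Q_bounds:
  assumes N: "N \<ge> 1" and mat: "material N c c1 c2" and \<alpha>: "\<bar>\<alpha>\<bar> < 1 / (3 * sqrt 11)"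
  shows "c * ((1 - 3 * (sqrt 11 * \<bar>\<alpha>\<bar>)) / (1 - sqrt 11 * \<bar>\<alpha>\<bar>)) \<le> best_margin Z_Q N \<alpha> c1 c2"
    and "c * K_G * \<bar>\<alpha>\<bar> \<le> 2 * (1 + sqrt 11 * \<bar>\<alpha>\<bar>) * (c - best_margin Z_Q N \<alpha> c1 c2)"
proof -
  note am = amplitude_bounds[OF \<alpha>]
  show "c * ((1 - 3 * (sqrt 11 * \<bar>\<alpha>\<bar>)) / (1 - sqrt 11 * \<bar>\<alpha>\<bar>)) \<le> best_margin Z_Q N \<alpha> c1 c2"
    using margin_inverse_field[OF N mat \<alpha>] Z_Q_maximiser(2)[OF N mat am(3) inverse_field_in_Z_Q[OF N am(3)]]
    by (rule order_trans)
  obtain z where z: "z \<in> Z_Q N \<alpha>" "margin N \<alpha> c1 c2 z = best_margin Z_Q N \<alpha> c1 c2"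
    using Z_Q_maximiser(1)[OF N mat am(3)] by blast
  let ?X = "c - best_margin Z_Q N \<alpha> c1 c2"
  have X: "0 \<le> ?X" using margin_le_c[OF N mat, of \<alpha> z] z(2) by simp
  have "0 \<le> c * K_G * \<bar>\<alpha>\<bar>" using mat K_G_pos by (simp add: material_def)
  \<comment> \<open>Lowering 3 to 1 here and enlarging 3 |\<alpha>| to sqrt 11 |\<alpha>| below
    gives the stated constants.\<close>
  then have "c * K_G * \<bar>\<alpha>\<bar> \<le> 3 * c * K_G * \<bar>\<alpha>\<bar>" by linarith
  also have "\<dots> \<le> 2 * (1 + 3 * \<bar>\<alpha>\<bar>) * ?X"
    using margin_Z_Q_le[OF N mat am(3) z(1)] z(2) by simp
  also have "\<dots> \<le> 2 * (1 + sqrt 11 * \<bar>\<alpha>\<bar>) * ?X"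
    by (intro mult_right_mono mult_left_mono add_left_mono am(2) X) simp
  finally show "c * K_G * \<bar>\<alpha>\<bar> \<le> 2 * (1 + sqrt 11 * \<bar>\<alpha>\<bar>) * ?X" .
qed

theorem theorem9:
  shows "(\<forall>(N::nat) (\<alpha>::real) (c::real) (c1::nat^3 \<Rightarrow> real) (c2::nat^3 \<Rightarrow> real).
      N \<ge> 1 \<and> 0 < \<bar>\<alpha>\<bar> \<and> \<bar>\<alpha>\<bar> < 1 / (3 * sqrt 11) \<and> material N c c1 c2 \<longrightarrow>
      (let \<delta> = sqrt 11 * \<bar>\<alpha>\<bar>;
           \<gamma>S = best_margin Z_S N \<alpha> c1 c2;
           \<gamma>Q = best_margin Z_Q N \<alpha> c1 c2
       in (\<exists>z\<in>Z_S N \<alpha>. margin N \<alpha> c1 c2 z = \<gamma>S \<and> (\<forall>z'\<in>Z_S N \<alpha>. margin N \<alpha> c1 c2 z' \<le> \<gamma>S)) \<and>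
          (\<exists>z\<in>Z_Q N \<alpha>. margin N \<alpha> c1 c2 z = \<gamma>Q \<and> (\<forall>z'\<in>Z_Q N \<alpha>. margin N \<alpha> c1 c2 z' \<le> \<gamma>Q)) \<and>
          \<gamma>S = c \<and>
          c * ((1 - 3 * \<delta>) / (1 - \<delta>)) \<le> \<gamma>Q \<and>
          \<gamma>Q \<le> c * (1 - K_G * \<bar>\<alpha>\<bar> / (2 * (1 + \<delta>))) \<and>
          c * (1 - K_G * \<bar>\<alpha>\<bar> / (2 * (1 + \<delta>))) < c \<and>
          (\<exists>z\<in>Z_S N \<alpha>. margin N \<alpha> c1 c2 z > 0) \<and>
          (\<exists>z\<in>Z_Q N \<alpha>. margin N \<alpha> c1 c2 z > 0))) \<and>
    (\<forall>\<alpha>0::real. 0 < \<alpha>0 \<and> \<alpha>0 < 1 / (3 * sqrt 11) \<longrightarrow>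
      (let \<delta>0 = sqrt 11 * \<alpha>0 in
       \<forall>(N::nat) (\<alpha>::real) (c::real) (c1::nat^3 \<Rightarrow> real) (c2::nat^3 \<Rightarrow> real).
         N \<ge> 1 \<and> 0 < \<bar>\<alpha>\<bar> \<and> \<bar>\<alpha>\<bar> \<le> \<alpha>0 \<and> material N c c1 c2 \<longrightarrow>
         c * K_G / (2 * (1 + \<delta>0)) * \<bar>\<alpha>\<bar> \<le> c - best_margin Z_Q N \<alpha> c1 c2 \<and>
         c - best_margin Z_Q N \<alpha> c1 c2 \<le> 2 * c * sqrt 11 / (1 - \<delta>0) * \<bar>\<alpha>\<bar>))"
proof (intro conjI allI impI)
  fix N :: nat and \<alpha> c :: real and c1 c2 :: "nat^3 \<Rightarrow> real"
  assume A: "N \<ge> 1 \<and> 0 < \<bar>\<alpha>\<bar> \<and> \<bar>\<alpha>\<bar> < 1 / (3 * sqrt 11) \<and> material N c c1 c2"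
  then have N: "N \<ge> 1" and a0: "0 < \<bar>\<alpha>\<bar>" and \<alpha>: "\<bar>\<alpha>\<bar> < 1 / (3 * sqrt 11)" and mat: "material N c c1 c2" by auto
  have c: "c > 0" using mat by (simp add: material_def)
  note am = amplitude_bounds[OF \<alpha>]
  let ?\<delta> = "sqrt 11 * \<bar>\<alpha>\<bar>" and ?S = "best_margin Z_S N \<alpha> c1 c2" and ?Q = "best_margin Z_Q N \<alpha> c1 c2"
  note S = best_margin_Z_S[OF N mat am(3)]
  note Q = best_margin_Z_Q_bounds[OF N mat \<alpha>]
  note id = identity_in_Z_S[of "2 * c" N \<alpha>] margin_identity[OF N mat am(3)]
  obtain z where z: "z \<in> Z_Q N \<alpha>" "margin N \<alpha> c1 c2 z = ?Q"
    using Z_Q_maximiser(1)[OF N mat am(3)] by blast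
  \<comment> \<open>The amplitude restriction is 3 \<delta> < 1, exactly what makes the lower bound
    positive.\<close>
  have "0 < (1 - 3 * ?\<delta>) / (1 - ?\<delta>)" using am(1) by (intro divide_pos_pos) auto
  then have "0 < c * ((1 - 3 * ?\<delta>) / (1 - ?\<delta>))" by (rule mult_pos_pos[OF c])
  then have Qpos: "0 < ?Q" using Q(1) by linarith
  have d: "0 < 2 * (1 + ?\<delta>)" using a0 by (simp add: add_pos_pos)
  have "c * (K_G * \<bar>\<alpha>\<bar> / (2 * (1 + ?\<delta>))) \<le> c - ?Q"
    using Q(2) d by (simp add: pos_divide_le_eq mult_ac)
  then have upper: "?Q \<le> c * (1 - K_G * \<bar>\<alpha>\<bar> / (2 * (1 + ?\<delta>)))"
    unfolding right_diff_distrib by simp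
  have "0 < K_G * \<bar>\<alpha>\<bar> / (2 * (1 + ?\<delta>))" by (rule divide_pos_pos[OF mult_pos_pos[OF K_G_pos a0] d])
  then have strict: "c * (1 - K_G * \<bar>\<alpha>\<bar> / (2 * (1 + ?\<delta>))) < c"
    using mult_strict_left_mono[OF _ c, of "1 - K_G * \<bar>\<alpha>\<bar> / (2 * (1 + ?\<delta>))" 1] by simp
  show "let \<delta> = sqrt 11 * \<bar>\<alpha>\<bar>;
           \<gamma>S = best_margin Z_S N \<alpha> c1 c2;
           \<gamma>Q = best_margin Z_Q N \<alpha> c1 c2
       in (\<exists>z\<in>Z_S N \<alpha>. margin N \<alpha> c1 c2 z = \<gamma>S \<and> (\<forall>z'\<in>Z_S N \<alpha>. margin N \<alpha> c1 c2 z' \<le> \<gamma>S)) \<and>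
          (\<exists>z\<in>Z_Q N \<alpha>. margin N \<alpha> c1 c2 z = \<gamma>Q \<and> (\<forall>z'\<in>Z_Q N \<alpha>. margin N \<alpha> c1 c2 z' \<le> \<gamma>Q)) \<and>
          \<gamma>S = c \<and>
          c * ((1 - 3 * \<delta>) / (1 - \<delta>)) \<le> \<gamma>Q \<and>
          \<gamma>Q \<le> c * (1 - K_G * \<bar>\<alpha>\<bar> / (2 * (1 + \<delta>))) \<and>
          c * (1 - K_G * \<bar>\<alpha>\<bar> / (2 * (1 + \<delta>))) < c \<and>
          (\<exists>z\<in>Z_S N \<alpha>. margin N \<alpha> c1 c2 z > 0) \<and>
          (\<exists>z\<in>Z_Q N \<alpha>. margin N \<alpha> c1 c2 z > 0)"
    unfolding Let_def S
  proof (intro conjI)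
    show "\<exists>z\<in>Z_S N \<alpha>. margin N \<alpha> c1 c2 z = c \<and> (\<forall>z'\<in>Z_S N \<alpha>. margin N \<alpha> c1 c2 z' \<le> c)"
      using id margin_le_c[OF N mat] by blast
    show "\<exists>z\<in>Z_Q N \<alpha>. margin N \<alpha> c1 c2 z = ?Q \<and> (\<forall>z'\<in>Z_Q N \<alpha>. margin N \<alpha> c1 c2 z' \<le> ?Q)"
      using z Z_Q_maximiser(2)[OF N mat am(3)] by blast
    show "\<exists>z\<in>Z_S N \<alpha>. margin N \<alpha> c1 c2 z > 0" using id c by metis
    show "\<exists>z\<in>Z_Q N \<alpha>. margin N \<alpha> c1 c2 z > 0" using z Qpos by metis
  qed (rule refl Q(1) upper strict)+
next
  fix \<alpha>0 :: real
  assume A0: "0 < \<alpha>0 \<and> \<alpha>0 < 1 / (3 * sqrt 11)"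
  show "let \<delta>0 = sqrt 11 * \<alpha>0 in
       \<forall>(N::nat) (\<alpha>::real) (c::real) (c1::nat^3 \<Rightarrow> real) (c2::nat^3 \<Rightarrow> real).
         N \<ge> 1 \<and> 0 < \<bar>\<alpha>\<bar> \<and> \<bar>\<alpha>\<bar> \<le> \<alpha>0 \<and> material N c c1 c2 \<longrightarrow>
         c * K_G / (2 * (1 + \<delta>0)) * \<bar>\<alpha>\<bar> \<le> c - best_margin Z_Q N \<alpha> c1 c2 \<and>
         c - best_margin Z_Q N \<alpha> c1 c2 \<le> 2 * c * sqrt 11 / (1 - \<delta>0) * \<bar>\<alpha>\<bar>"
    unfolding Let_def
  proof (intro allI impI)
    fix N :: nat and \<alpha> c :: real and c1 c2 :: "nat^3 \<Rightarrow> real"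
    assume A: "N \<ge> 1 \<and> 0 < \<bar>\<alpha>\<bar> \<and> \<bar>\<alpha>\<bar> \<le> \<alpha>0 \<and> material N c c1 c2"
    then have N: "N \<ge> 1" and a0: "\<bar>\<alpha>\<bar> \<le> \<alpha>0" and mat: "material N c c1 c2" by auto
    have \<alpha>: "\<bar>\<alpha>\<bar> < 1 / (3 * sqrt 11)" using a0 A0 by linarith
    have c: "c > 0" using mat by (simp add: material_def)
    note Q = best_margin_Z_Q_bounds[OF N mat \<alpha>]
    let ?X = "c - best_margin Z_Q N \<alpha> c1 c2" and ?\<delta> = "sqrt 11 * \<bar>\<alpha>\<bar>" and ?\<eta> = "sqrt 11 * \<alpha>0"
    have \<delta>: "?\<delta> \<le> ?\<eta>" using a0 by (intro mult_left_mono) auto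
    have "\<bar>\<alpha>0\<bar> < 1 / (3 * sqrt 11)" using A0 by simp
    from amplitude_bounds(1)[OF this] have \<delta>0: "?\<eta> < 1" "0 \<le> ?\<eta>" using A0 by auto
    have \<delta>1: "?\<delta> < 1" using \<delta> \<delta>0(1) by (rule le_less_trans)
    \<comment> \<open>The sign of the deficit is read off from its lower bound; it is needed to
      enlarge \<delta> to \<delta>_0 in the factor in front.\<close>
    have X: "0 \<le> ?X"
    proof -
      have "0 \<le> 2 * (1 + ?\<delta>) * ?X" using Q(2) c K_G_pos by (intro order_trans[OF _ Q(2)]) simp
      moreover have "0 < 2 * (1 + ?\<delta>)" by (simp add: add_pos_nonneg)
      ultimately show ?thesis by (simp only: zero_le_mult_iff) linarith
    qed
    have "c * K_G * \<bar>\<alpha>\<bar> \<le> 2 * (1 + ?\<eta>) * ?X"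
      by (rule order_trans[OF Q(2)]) (intro mult_right_mono mult_left_mono add_left_mono \<delta> X, simp)
    then have lower: "c * K_G / (2 * (1 + ?\<eta>)) * \<bar>\<alpha>\<bar> \<le> ?X"
      using \<delta>0 by (simp add: pos_divide_le_eq mult_ac)
    have "c * ((1 - 3 * ?\<delta>) / (1 - ?\<delta>)) = c - 2 * c * (?\<delta> / (1 - ?\<delta>))"
    proof -
      have "1 - ?\<delta> \<noteq> 0" using \<delta>1 by linarith
      then show ?thesis by (simp add: field_simps)
    qed
    then have "?X \<le> 2 * c * (?\<delta> / (1 - ?\<delta>))" using Q(1) by linarith
    \<comment> \<open>Only the denominator is replaced by its value at \<alpha>_0; the numerator
      keeps the linear factor |\<alpha>|.\<close>
    also have "\<dots> \<le> 2 * c * (?\<delta> / (1 - ?\<eta>))"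
      using c \<delta> \<delta>0 \<delta>1 by (intro mult_left_mono divide_left_mono mult_pos_pos) auto
    also have "\<dots> = 2 * c * sqrt 11 / (1 - ?\<eta>) * \<bar>\<alpha>\<bar>" by simp
    finally show "c * K_G / (2 * (1 + ?\<eta>)) * \<bar>\<alpha>\<bar> \<le> ?X \<and> ?X \<le> 2 * c * sqrt 11 / (1 - ?\<eta>) * \<bar>\<alpha>\<bar>"
      using lower by blast
  qed
qed

end
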